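(* There is a randomized algorithm and an absolute constant $C>0$ such that, given a matrix $A\in\mathbb{R}^{n\times t}$ all of whose columns have $\ell_2$-norm at most $1$, the algorithm runs in time $O(\mathrm{nnz}(A))$ and with high probability outputs a vector $x\in\{-1,1\}^t$ with $\|Ax\|_\infty\le C\sqrt{\log t\cdot\log n}$.
   Context: $\mathrm{nnz}(A)$ denotes the number of nonzero entries of $A$. *)

theory Defs
  imports "HOL-Probability.Probability_Mass_Function" "Jordan_Normal_Form.Matrix"
begin

section \<open>Matrices, norms and sparsity\<close>

definition l2_norm :: "real vec \<Rightarrow> real" where
  "l2_norm v = L2_set (vec_index v) {..<dim_vec v}"

text \<open>Only meaningful for vectors of positive dimension, because of the maximum.\<close>

definition linf_norm :: "real vec \<Rightarrow> real" where
  "linf_norm v = Max ((\<lambda>i. \<bar>vec_index v i\<bar>) ` {..<dim_vec v})"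

definition sign_vecs :: "nat \<Rightarrow> real vec set" where
  "sign_vecs t = {x \<in> carrier_vec t. \<forall>j<t. vec_index x j \<in> {-1, 1}}"

definition nnz :: "real mat \<Rightarrow> nat" where
  "nnz A = card {(i, j). i < dim_row A \<and> j < dim_col A \<and> A $$ (i, j) \<noteq> 0}"

text \<open>The positions of the nonzero entries, each once, column after column.\<close>

definition nz_positions :: "real mat \<Rightarrow> (nat \<times> nat) list" where
  "nz_positions A =
     [(i, j). j \<leftarrow> [0..<dim_col A], i \<leftarrow> [0..<dim_row A], A $$ (i, j) \<noteq> 0]"

section \<open>A randomized real RAM\<close>

text \<open>
  Programs are finite texts over a memory with natural-number variables, real variables,
  and arrays (of naturals and of reals) indexed by naturals; variables and arrays are named by
  natural-number literals in the program text, so each program uses finitely many of them.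
  As is usual for the real RAM, arithmetic on reals is exact and every primitive instruction
  and every test costs one time unit, and there is no rounding from reals to naturals.  The
  only operations on naturals are addition and truncated subtraction, so a computation of
  \<open>T\<close> steps lengthens the binary representations of naturals by at most
  \<open>O(T)\<close> bits.  Constants in a program
  are rational.

  \<open>Flip x p\<close> is the source of randomness: it tosses a fresh coin whose
  probability of heads is the current value of the real variable \<open>p\<close> (clamped to
  \<open>[0, 1]\<close>) and stores the outcome, 1 or 0, in the natural variable \<open>x\<close>.
\<close>

datatype test =
    NLess nat nat
  | RLess nat nat

datatype instr =
    NConst nat nat
  | NAdd nat nat nat
  | NSub nat nat nat
  | NLoad nat nat nat
  | NStore nat nat nat
  | RConst nat rat
  | RCast nat nat
  | RAdd nat nat nat
  | RSub nat nat nat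
  | RMul nat nat nat
  | RDiv nat nat nat
  | RLoad nat nat nat
  | RStore nat nat nat
  | Flip nat nat
  | Cond test "instr list" "instr list"
  | Loop test "instr list"

type_synonym prog = "instr list"

record memory =
  nvar :: "nat \<Rightarrow> nat"
  rvar :: "nat \<Rightarrow> real"
  narr :: "nat \<Rightarrow> nat \<Rightarrow> nat"
  rarr :: "nat \<Rightarrow> nat \<Rightarrow> real"

fun holds :: "test \<Rightarrow> memory \<Rightarrow> bool" where
  "holds (NLess x y) s \<longleftrightarrow> nvar s x < nvar s y"
| "holds (RLess x y) s \<longleftrightarrow> rvar s x < rvar s y"

definition set_nvar :: "nat \<Rightarrow> nat \<Rightarrow> memory \<Rightarrow> memory" where
  "set_nvar x k s = s\<lparr>nvar := (nvar s)(x := k)\<rparr>"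

definition set_rvar :: "nat \<Rightarrow> real \<Rightarrow> memory \<Rightarrow> memory" where
  "set_rvar x r s = s\<lparr>rvar := (rvar s)(x := r)\<rparr>"

definition set_narr :: "nat \<Rightarrow> nat \<Rightarrow> nat \<Rightarrow> memory \<Rightarrow> memory" where
  "set_narr a i k s = s\<lparr>narr := (narr s)(a := (narr s a)(i := k))\<rparr>"

definition set_rarr :: "nat \<Rightarrow> nat \<Rightarrow> real \<Rightarrow> memory \<Rightarrow> memory" where
  "set_rarr a i r s = s\<lparr>rarr := (rarr s)(a := (rarr s a)(i := r))\<rparr>"

text \<open>
  A configuration consists of the instructions still to be executed and the memory; the
  machine has halted when no instruction is left.
\<close>

fun step :: "prog \<times> memory \<Rightarrow> (prog \<times> memory) pmf" where
  "step ([], s) = return_pmf ([], s)"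
| "step (NConst x k # Q, s) = return_pmf (Q, set_nvar x k s)"
| "step (NAdd x y z # Q, s) = return_pmf (Q, set_nvar x (nvar s y + nvar s z) s)"
| "step (NSub x y z # Q, s) = return_pmf (Q, set_nvar x (nvar s y - nvar s z) s)"
| "step (NLoad x a i # Q, s) = return_pmf (Q, set_nvar x (narr s a (nvar s i)) s)"
| "step (NStore a i x # Q, s) = return_pmf (Q, set_narr a (nvar s i) (nvar s x) s)"
| "step (RConst x q # Q, s) = return_pmf (Q, set_rvar x (real_of_rat q) s)"
| "step (RCast x y # Q, s) = return_pmf (Q, set_rvar x (real (nvar s y)) s)"
| "step (RAdd x y z # Q, s) = return_pmf (Q, set_rvar x (rvar s y + rvar s z) s)"
| "step (RSub x y z # Q, s) = return_pmf (Q, set_rvar x (rvar s y - rvar s z) s)"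
| "step (RMul x y z # Q, s) = return_pmf (Q, set_rvar x (rvar s y * rvar s z) s)"
| "step (RDiv x y z # Q, s) = return_pmf (Q, set_rvar x (rvar s y / rvar s z) s)"
| "step (RLoad x a i # Q, s) = return_pmf (Q, set_rvar x (rarr s a (nvar s i)) s)"
| "step (RStore a i x # Q, s) = return_pmf (Q, set_rarr a (nvar s i) (rvar s x) s)"
| "step (Flip x p # Q, s) =
     map_pmf (\<lambda>b. (Q, set_nvar x (of_bool b) s)) (bernoulli_pmf (rvar s p))"
| "step (Cond b P1 P2 # Q, s) = return_pmf ((if holds b s then P1 else P2) @ Q, s)"
| "step (Loop b P # Q, s) = return_pmf (if holds b s then P @ Loop b P # Q else Q, s)"

primrec run :: "nat \<Rightarrow> prog \<times> memory \<Rightarrow> (prog \<times> memory) pmf" where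
  "run 0 c = return_pmf c"
| "run (Suc k) c = bind_pmf (step c) (run k)"

text \<open>
  Worst-case running time: every computation path, whatever the coin tosses, halts in time.
\<close>

definition halts_within :: "prog \<Rightarrow> memory \<Rightarrow> nat \<Rightarrow> bool" where
  "halts_within P s T \<longleftrightarrow> (\<forall>(Q, s') \<in> set_pmf (run T (P, s)). Q = [])"

section \<open>Input and output\<close>

text \<open>
  The input matrix is given by its numbers of rows, columns and nonzero entries (natural
  variables 0, 1, 2) and the column-by-column list of its nonzero entries: row indices
  in natural array 0, column indices in natural array 1, values in real array 0.
  All other memory is 0, except that the output array (real array 1) starts as the
  all-ones vector: a matrix may have far more (zero) columns than nonzero entries, in which case
  no algorithm can write all \<open>t\<close> output entries in time \<open>O(nnz(A))\<close>.
\<close>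

definition input_memory :: "real mat \<Rightarrow> memory" where
  "input_memory A = (let es = nz_positions A; m = length es in
     \<lparr> nvar = (\<lambda>_. 0)(0 := dim_row A, 1 := dim_col A, 2 := m),
       rvar = (\<lambda>_. 0),
       narr = (\<lambda>_ _. 0)(0 := (\<lambda>k. if k < m then fst (es ! k) else 0),
                        1 := (\<lambda>k. if k < m then snd (es ! k) else 0)),
       rarr = (\<lambda>_ _. 0)(0 := (\<lambda>k. if k < m then A $$ (es ! k) else 0),
                        1 := (\<lambda>j. if j < dim_col A then 1 else 0)) \<rparr>)"

text \<open>
  The distribution of the contents of the output array after \<open>T\<close> steps, on input
  \<open>A\<close>; it is the output distribution as soon as the program halts within \<open>T\<close>.
\<close>

definition output_pmf :: "prog \<Rightarrow> real mat \<Rightarrow> nat \<Rightarrow> real vec pmf" where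
  "output_pmf P A T =
     map_pmf (\<lambda>(_, s). Matrix.vec (dim_col A) (rarr s 1)) (run T (P, input_memory A))"

lemma set_nz_positions:
  "set (nz_positions A) = {(i, j). i < dim_row A \<and> j < dim_col A \<and> A $$ (i, j) \<noteq> 0}"
  by (auto simp: nz_positions_def)

lemma distinct_nz_positions: "distinct (nz_positions A)"
proof -
  have *: "distinct (concat (map (\<lambda>j. concat (map (\<lambda>i. if P i j then [(i, j)] else [])
      [0..<n])) [0..<m]))" for P :: "nat \<Rightarrow> nat \<Rightarrow> bool" and n m
  proof (induction m)
    case (Suc m)
    have "distinct (concat (map (\<lambda>i. if P i m then [(i, m)] else []) [0..<n]))"
      by (induction n) auto
    with Suc show ?case by auto
  qed simp
  show ?thesis unfolding nz_positions_def by (rule *)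
qed

lemma length_nz_positions: "length (nz_positions A) = nnz A"
  by (metis distinct_card distinct_nz_positions nnz_def set_nz_positions)

end

theory Submission
  imports Defs "HOL-Probability.Hoeffding"
begin

text \<open>
  The algorithm is the self-balancing walk: with \<open>w\<close> the signed sum of the columns seen so far, the
  next column \<open>v\<close> gets sign 1 with probability \<open>1/2 - \<langle>w, v\<rangle> / (2c)\<close>.  As long as no probability is
  clamped, \<open>w\<close> stays sub-Gaussian with variance proxy \<open>c\<close>, i.e. \<open>E exp \<langle>\<theta>, w\<rangle> \<le> exp (c |\<theta>|\<^sup>2 / 2)\<close> for all
  \<open>\<theta>\<close>: by Hoeffding's lemma a step with \<open>s = \<langle>\<theta>, v\<rangle>\<close> costs a factor \<open>exp (s\<^sup>2 / 2)\<close> and replaces \<open>\<theta>\<close> by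
  \<open>\<theta> - (s/c) v\<close>, which lowers \<open>c |\<theta>|\<^sup>2\<close> by at least \<open>(2 - 1/c) s\<^sup>2 \<ge> s\<^sup>2\<close>.  Hence clamping ever happens with
  probability at most \<open>2t exp (- c/2)\<close>, and otherwise all entries of \<open>w\<close> are \<open>O(sqrt (c log n))\<close> with high
  probability, so \<open>c\<close> proportional to \<open>log t\<close> suffices.

  Doubling up to \<open>t\<close> may exceed the time \<open>O(nnz(A))\<close>, so it is cut off after \<open>nnz(A)\<close> rounds; then \<open>c\<close> is
  larger than the number of nonzero columns and clamping is impossible.
\<close>

section \<open>The self-balancing walk\<close>

text \<open>Hoeffding's lemma for a sign of mean \<open>2 * p - 1\<close>. A sign is an affine image
  of a 0/1 variable, hence the parameter \<open>2 * b\<close> and the factor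
  \<open>exp (- b)\<close> in the proof.\<close>

lemma bernoulli_mgf_nonneg:
  fixes p b :: real
  assumes "0 \<le> p" "p \<le> 1" "0 \<le> b"
  shows "p * exp b + (1 - p) * exp (- b) \<le> exp ((2 * p - 1) * b + b\<^sup>2 / 2)"
proof -
  have pos: "1 + p * (exp (2 * b) - 1) > 0"
    using assms by (intro add_pos_nonneg mult_nonneg_nonneg) auto
  have "- (2 * b) * p + ln (1 + p * (exp (2 * b) - 1)) \<le> (2 * b)\<^sup>2 / 8"
    using Hoeffdings_lemma_aux[of "2 * b" p] assms by simp
  hence "ln (1 + p * (exp (2 * b) - 1)) \<le> 2 * b * p + b\<^sup>2 / 2"
    by (simp add: power2_eq_square)
  hence "1 + p * (exp (2 * b) - 1) \<le> exp (2 * b * p + b\<^sup>2 / 2)"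
    using pos by (metis exp_le_cancel_iff exp_ln)
  hence "exp (- b) * (1 + p * (exp (2 * b) - 1)) \<le> exp (- b) * exp (2 * b * p + b\<^sup>2 / 2)"
    by simp
  also have "exp (- b) * exp (2 * b * p + b\<^sup>2 / 2) = exp ((2 * p - 1) * b + b\<^sup>2 / 2)"
    by (simp add: exp_add[symmetric] algebra_simps)
  also have "exp (- b) * (1 + p * (exp (2 * b) - 1)) =
      p * (exp (- b) * exp (2 * b)) + (1 - p) * exp (- b)"
    by (simp add: algebra_simps)
  also have "exp (- b) * exp (2 * b) = exp b"
    by (simp add: exp_add[symmetric])
  finally show ?thesis .
qed

lemma bernoulli_mgf:
  fixes p b :: real
  assumes "0 \<le> p" "p \<le> 1"
  shows "p * exp b + (1 - p) * exp (- b) \<le> exp ((2 * p - 1) * b + b\<^sup>2 / 2)"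
proof (cases "0 \<le> b")
  \<comment> \<open>Exchanging the two outcomes replaces \<open>p\<close> by \<open>1 - p\<close>
    and \<open>b\<close> by \<open>- b\<close>.\<close>
  case False
  with bernoulli_mgf_nonneg[of "1 - p" "- b"] assms show ?thesis
    by (simp add: algebra_simps)
qed (use assms bernoulli_mgf_nonneg in blast)

text \<open>Conditioning on the first stage; finite supports settle all questions of
  integrability.\<close>

lemma expectation_bind_le:
  fixes f g :: "_ \<Rightarrow> real"
  assumes "finite (set_pmf p)" "\<And>x. x \<in> set_pmf p \<Longrightarrow> finite (set_pmf (q x))"
    and "\<And>x. x \<in> set_pmf p \<Longrightarrow> measure_pmf.expectation (q x) f \<le> g x"
  shows "measure_pmf.expectation (bind_pmf p q) f \<le> measure_pmf.expectation p g"
proof -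
  have "measure_pmf.expectation (bind_pmf p q) f =
      (\<Sum>x\<in>set_pmf p. pmf p x *\<^sub>R measure_pmf.expectation (q x) f)"
    by (rule pmf_expectation_bind) (use assms in auto)
  also have "\<dots> \<le> (\<Sum>x\<in>set_pmf p. pmf p x *\<^sub>R g x)"
    using assms by (intro sum_mono scaleR_left_mono) auto
  also have "\<dots> = measure_pmf.expectation p g"
    by (rule integral_measure_pmf[symmetric]) (use assms in \<open>auto simp: set_pmf_iff\<close>)
  finally show ?thesis .
qed

lemma expectation_of_bool: "measure_pmf.expectation p (\<lambda>x. of_bool (P x)) = measure_pmf.prob p {x. P x}"
proof -
  have "(\<lambda>x. of_bool (P x) :: real) = indicator {x. P x}"
    by (auto simp: fun_eq_iff indicator_def)
  thus ?thesis by simp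
qed

lemma expectation_mono_finite:
  fixes f g :: "_ \<Rightarrow> real"
  assumes "finite (set_pmf p)" "\<And>x. x \<in> set_pmf p \<Longrightarrow> f x \<le> g x"
  shows "measure_pmf.expectation p f \<le> measure_pmf.expectation p g"
  using assms by (intro integral_mono_AE) (auto intro: integrable_measure_pmf_finite simp: AE_measure_pmf_iff)

section \<open>The walk and its reachable states\<close>

locale balancing_walk =
  fixes a :: "nat \<Rightarrow> nat \<Rightarrow> real" and n t :: nat and c :: real
begin

definition row_sum :: "(nat \<Rightarrow> real) \<Rightarrow> nat \<Rightarrow> real" where
  "row_sum x i = (\<Sum>j<t. a i j * x j)"

definition drift :: "nat \<Rightarrow> (nat \<Rightarrow> real) \<Rightarrow> real" where
  "drift j x = (\<Sum>i<n. a i j * row_sum x i)"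

definition zero_col :: "nat \<Rightarrow> bool" where
  "zero_col j \<longleftrightarrow> (\<forall>i<n. a i j = 0)"

text \<open>\<open>drift j x\<close> is the inner product of column \<open>j\<close> with the signed
  sum. A zero column keeps the entry 0 (no sign chosen), because the program never visits it. The
  clamping is done by \<open>bernoulli_pmf\<close> itself.\<close>

definition walk_step :: "nat \<Rightarrow> (nat \<Rightarrow> real) \<Rightarrow> (nat \<Rightarrow> real) pmf" where
  "walk_step j x = (if zero_col j then return_pmf x
     else map_pmf (\<lambda>b. x(j := 2 * of_bool b - 1)) (bernoulli_pmf (1 / 2 - drift j x / (2 * c))))"

primrec walk :: "nat list \<Rightarrow> (nat \<Rightarrow> real) \<Rightarrow> (nat \<Rightarrow> real) pmf" where
  "walk [] x = return_pmf x"
| "walk (j # js) x = bind_pmf (walk_step j x) (walk js)"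

abbreviation walk_upto :: "nat \<Rightarrow> (nat \<Rightarrow> real) pmf" where
  "walk_upto k \<equiv> walk [0..<k] (\<lambda>_. 0)"

lemma walk_single: "walk [j] = walk_step j"
proof -
  have *: "walk [] = return_pmf" by (simp add: fun_eq_iff)
  show ?thesis by (rule ext) (simp add: * bind_return_pmf' del: walk.simps(1))
qed

lemma walk_append: "walk (js @ js') x = bind_pmf (walk js x) (walk js')"
  by (induction js arbitrary: x) (auto simp: bind_assoc_pmf bind_return_pmf intro!: bind_pmf_cong)

text \<open>\<open>walk\<close> peels off the first column, as the program's loop does; the
  estimates by induction on \<open>k\<close> need the last column peeled off instead.\<close>

lemma walk_upto_Suc: "walk_upto (Suc k) = bind_pmf (walk_upto k) (walk_step k)"
  by (simp add: walk_append walk_single del: walk.simps)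

lemma finite_walk_step [simp]: "finite (set_pmf (walk_step j x))"
  by (auto simp: walk_step_def)

lemma finite_walk [simp]: "finite (set_pmf (walk js x))"
  by (induction js arbitrary: x) auto

definition reachable :: "nat \<Rightarrow> (nat \<Rightarrow> real) \<Rightarrow> bool" where
  "reachable k x \<longleftrightarrow> (\<forall>j\<ge>k. x j = 0) \<and> (\<forall>j<k. if zero_col j then x j = 0 else x j \<in> {-1, 1})"

lemma reachable_walk_step:
  "reachable k x \<Longrightarrow> x' \<in> set_pmf (walk_step k x) \<Longrightarrow> reachable (Suc k) x'"
  by (auto simp: reachable_def walk_step_def less_Suc_eq split: if_splits)

lemma reachable_walk_upto: "x \<in> set_pmf (walk_upto k) \<Longrightarrow> reachable k x"
proof (induction k arbitrary: x)
  case (Suc k)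
  thus ?case unfolding walk_upto_Suc using reachable_walk_step by auto
qed (simp add: reachable_def)

text \<open>
  Signs of columns at or after \<open>j\<close> are erased, so that \<open>tame k x\<close> says that no probability
  had to be clamped on the way to \<open>x\<close>.
\<close>

definition tame :: "nat \<Rightarrow> (nat \<Rightarrow> real) \<Rightarrow> bool" where
  "tame k x \<longleftrightarrow> (\<forall>j<k. \<bar>drift j (\<lambda>i. if i < j then x i else 0)\<bar> \<le> c)"

lemma truncate_reachable: "reachable k x \<Longrightarrow> (\<lambda>i. if i < k then x i else 0) = x"
  by (auto simp: reachable_def fun_eq_iff)

lemma tame_Suc: "reachable k x \<Longrightarrow> tame (Suc k) x \<longleftrightarrow> tame k x \<and> \<bar>drift k x\<bar> \<le> c"
  by (auto simp: tame_def less_Suc_eq truncate_reachable)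

text \<open>The sign of column \<open>k\<close> is drawn after its probability is computed, so it
  cannot influence the condition at \<open>k\<close> or earlier.\<close>

lemma tame_Suc_upd:
  assumes "reachable k x"
  shows "tame (Suc k) (x(k := e)) \<longleftrightarrow> tame k x \<and> \<bar>drift k x\<bar> \<le> c"
proof -
  have "(\<lambda>i. if i < j then (x(k := e)) i else 0) = (\<lambda>i. if i < j then x i else 0)" if "j \<le> k" for j
    using that by (auto simp: fun_eq_iff)
  hence "tame (Suc k) (x(k := e)) \<longleftrightarrow> tame (Suc k) x"
    unfolding tame_def by (auto simp: less_Suc_eq_le)
  thus ?thesis using tame_Suc[OF assms] by simp
qed

lemma row_sum_upd:
  assumes "k < t" "x k = 0"
  shows "row_sum (x(k := e)) i = row_sum x i + e * a i k"
proof -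
  have "row_sum (x(k := e)) i = (\<Sum>j<t. a i j * x j + (if j = k then a i k * e else 0))"
    unfolding row_sum_def by (rule sum.cong) (use assms in auto)
  also have "\<dots> = row_sum x i + e * a i k"
    using assms by (simp add: row_sum_def sum.distrib)
  finally show ?thesis .
qed

end

section \<open>Sub-Gaussian bounds for unit columns\<close>

locale unit_balancing_walk = balancing_walk +
  assumes unit_cols: "j < t \<Longrightarrow> (\<Sum>i<n. (a i j)\<^sup>2) \<le> 1"
    and c_ge_1: "1 \<le> c"
begin

text \<open>
  The bias \<open>- drift k x / c\<close> of the sign of column \<open>k\<close> turns the test vector \<open>\<theta>\<close> into
  \<open>\<theta> - (\<langle>\<theta>, a\<^sub>k\<rangle> / c) a\<^sub>k\<close>.
\<close>

lemma mgf_walk_step: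
  fixes \<theta> :: "nat \<Rightarrow> real"
  assumes k: "k < t" and x: "reachable k x"
  defines "s \<equiv> (\<Sum>i<n. \<theta> i * a i k)"
  shows "measure_pmf.expectation (walk_step k x)
      (\<lambda>x. of_bool (tame (Suc k) x) * exp (\<Sum>i<n. \<theta> i * row_sum x i)) \<le>
    exp (s\<^sup>2 / 2) * (of_bool (tame k x) * exp (\<Sum>i<n. (\<theta> i - s / c * a i k) * row_sum x i))"
    (is "?L \<le> ?R")
proof (cases "zero_col k")
  case True
  hence s: "s = 0" by (auto simp: s_def zero_col_def)
  have "tame (Suc k) x \<Longrightarrow> tame k x" by (simp add: tame_def)
  with True s show ?thesis by (auto simp: walk_step_def)
next
  case False
  let ?S = "\<Sum>i<n. \<theta> i * row_sum x i"
  let ?p = "1 / 2 - drift k x / (2 * c)"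
  have xk: "x k = 0" using x by (simp add: reachable_def)
  have S: "(\<Sum>i<n. \<theta> i * row_sum (x(k := e)) i) = ?S + e * s" for e
    by (simp add: row_sum_upd[of k x e] k xk s_def algebra_simps sum.distrib sum_distrib_left)
  have L: "?L = measure_pmf.expectation (bernoulli_pmf ?p)
      (\<lambda>b. of_bool (tame k x \<and> \<bar>drift k x\<bar> \<le> c) * exp (?S + (2 * of_bool b - 1) * s))"
    using False by (simp add: walk_step_def tame_Suc_upd[OF x] S)
  show ?thesis
  proof (cases "tame k x \<and> \<bar>drift k x\<bar> \<le> c")
    case T: True
    have p: "0 \<le> ?p" "?p \<le> 1" using T c_ge_1 by (auto simp: field_simps abs_le_iff)
    have split: "exp (?S + s) * q + exp (?S - s) * (1 - q) = exp ?S * (q * exp s + (1 - q) * exp (- s))" for q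
      by (simp add: exp_add exp_diff exp_minus algebra_simps divide_inverse)
    have "?L = exp ?S * (?p * exp s + (1 - ?p) * exp (- s))"
      unfolding L integral_bernoulli_pmf[OF p] using T split[of ?p] by simp
    also have "\<dots> \<le> exp ?S * exp ((2 * ?p - 1) * s + s\<^sup>2 / 2)"
      by (intro mult_left_mono bernoulli_mgf p) auto
    also have "\<dots> = exp (s\<^sup>2 / 2) * exp (?S - s / c * drift k x)"
      using c_ge_1 by (simp add: exp_add[symmetric] field_simps)
    also have "?S - s / c * drift k x = (\<Sum>i<n. (\<theta> i - s / c * a i k) * row_sum x i)"
      by (simp add: drift_def sum_distrib_left sum_subtractf algebra_simps)
    finally show ?thesis using T by simp
  next
    case F: False
    have "?L = 0" unfolding L using F by auto
    thus ?thesis by simp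
  qed
qed

text \<open>Peeling off the last column changes the test vector, so the induction ranges over all
  \<open>\<theta>\<close>. The factor lost in each step is paid for by the decrease of the squared
  norm of \<open>\<theta>\<close>.\<close>

lemma mgf_walk:
  assumes "k \<le> t"
  shows "measure_pmf.expectation (walk_upto k)
      (\<lambda>x. of_bool (tame k x) * exp (\<Sum>i<n. \<theta> i * row_sum x i)) \<le> exp (c / 2 * (\<Sum>i<n. (\<theta> i)\<^sup>2))"
  using assms
proof (induction k arbitrary: \<theta>)
  case 0
  have "row_sum (\<lambda>_. 0) i = 0" for i by (simp add: row_sum_def)
  moreover have "0 \<le> c / 2 * (\<Sum>i<n. (\<theta> i)\<^sup>2)"
    using c_ge_1 by (intro mult_nonneg_nonneg sum_nonneg) auto
  ultimately show ?case by (simp add: tame_def)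
next
  case (Suc k)
  define s where "s = (\<Sum>i<n. \<theta> i * a i k)"
  define \<theta>' where "\<theta>' = (\<lambda>i. \<theta> i - s / c * a i k)"
  have "measure_pmf.expectation (walk_upto (Suc k))
      (\<lambda>x. of_bool (tame (Suc k) x) * exp (\<Sum>i<n. \<theta> i * row_sum x i)) \<le>
    measure_pmf.expectation (walk_upto k)
      (\<lambda>x. exp (s\<^sup>2 / 2) * (of_bool (tame k x) * exp (\<Sum>i<n. \<theta>' i * row_sum x i)))"
    unfolding walk_upto_Suc s_def \<theta>'_def
  proof (rule expectation_bind_le)
    fix x assume "x \<in> set_pmf (walk_upto k)"
    thus "measure_pmf.expectation (walk_step k x)
        (\<lambda>x. of_bool (tame (Suc k) x) * exp (\<Sum>i<n. \<theta> i * row_sum x i)) \<le>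
      exp ((\<Sum>i<n. \<theta> i * a i k)\<^sup>2 / 2) * (of_bool (tame k x) *
        exp (\<Sum>i<n. (\<theta> i - (\<Sum>i<n. \<theta> i * a i k) / c * a i k) * row_sum x i))"
      using Suc.prems by (intro mgf_walk_step reachable_walk_upto) auto
  qed auto
  also have "\<dots> \<le> exp (s\<^sup>2 / 2) * exp (c / 2 * (\<Sum>i<n. (\<theta>' i)\<^sup>2))"
    using Suc.IH[of \<theta>'] Suc.prems by simp
  also have "\<dots> = exp (s\<^sup>2 / 2 + c / 2 * (\<Sum>i<n. (\<theta>' i)\<^sup>2))"
    by (simp add: exp_add)
  also have "\<dots> \<le> exp (c / 2 * (\<Sum>i<n. (\<theta> i)\<^sup>2))"
  proof -
    have "(\<Sum>i<n. (\<theta>' i)\<^sup>2) = (\<Sum>i<n. (\<theta> i)\<^sup>2 - 2 * (s / c) * (\<theta> i * a i k) + (s / c)\<^sup>2 * (a i k)\<^sup>2)"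
      unfolding \<theta>'_def by (intro sum.cong refl) (simp add: power2_eq_square algebra_simps)
    also have "\<dots> = (\<Sum>i<n. (\<theta> i)\<^sup>2) - 2 * (s / c) * s + (s / c)\<^sup>2 * (\<Sum>i<n. (a i k)\<^sup>2)"
      by (simp only: sum.distrib sum_subtractf sum_distrib_left s_def)
    also have "\<dots> \<le> (\<Sum>i<n. (\<theta> i)\<^sup>2) - 2 * (s / c) * s + (s / c)\<^sup>2 * 1"
      using unit_cols[of k] Suc.prems by (intro add_left_mono mult_left_mono) auto
    finally have "c / 2 * (\<Sum>i<n. (\<theta>' i)\<^sup>2) \<le>
        c / 2 * ((\<Sum>i<n. (\<theta> i)\<^sup>2) - 2 * (s / c) * s + (s / c)\<^sup>2 * 1)"
      using c_ge_1 by (intro mult_left_mono) auto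
    also have "\<dots> = c / 2 * (\<Sum>i<n. (\<theta> i)\<^sup>2) - s\<^sup>2 + s\<^sup>2 / (2 * c)"
      using c_ge_1 by (simp add: field_simps power2_eq_square)
    \<comment> \<open>Here \<open>1 \<le> c\<close> enters: half of the gain \<open>s^2\<close>
      covers this quadratic term, the other half Hoeffding's factor.\<close>
    also have "s\<^sup>2 / (2 * c) \<le> s\<^sup>2 / 2"
      using c_ge_1 by (intro divide_left_mono) auto
    finally show ?thesis by simp
  qed
  finally show ?case .
qed

lemma upper_tail:
  assumes "k \<le> t" and \<theta>: "(\<Sum>i<n. (\<theta> i)\<^sup>2) \<le> 1" and "0 \<le> r"
  shows "measure_pmf.prob (walk_upto k) {x. tame k x \<and> r < (\<Sum>i<n. \<theta> i * row_sum x i)}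
    \<le> exp (- (r\<^sup>2 / (2 * c)))"
proof -
  \<comment> \<open>Chernoff's method with the multiplier \<open>l\<close> that minimises
    \<open>- l * r + c * l^2 / 2\<close>.\<close>
  let ?l = "r / c"
  have "measure_pmf.prob (walk_upto k) {x. tame k x \<and> r < (\<Sum>i<n. \<theta> i * row_sum x i)} =
     measure_pmf.expectation (walk_upto k) (\<lambda>x. of_bool (tame k x \<and> r < (\<Sum>i<n. \<theta> i * row_sum x i)))"
    by (rule expectation_of_bool[symmetric])
  also have "\<dots> \<le> measure_pmf.expectation (walk_upto k) (\<lambda>x. exp (- (?l * r)) *
      (of_bool (tame k x) * exp (\<Sum>i<n. (?l * \<theta> i) * row_sum x i)))"
  proof (rule expectation_mono_finite)
    fix x
    have "?l * r \<le> (\<Sum>i<n. ?l * \<theta> i * row_sum x i)" if "r < (\<Sum>i<n. \<theta> i * row_sum x i)"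
      using that assms c_ge_1 mult_left_mono[of r "\<Sum>i<n. \<theta> i * row_sum x i" ?l]
      by (simp add: sum_distrib_left mult.assoc)
    thus "of_bool (tame k x \<and> r < (\<Sum>i<n. \<theta> i * row_sum x i)) \<le> exp (- (?l * r)) *
        (of_bool (tame k x) * exp (\<Sum>i<n. ?l * \<theta> i * row_sum x i))"
      by (auto simp: exp_add[symmetric])
  qed simp
  also have "\<dots> \<le> exp (- (?l * r)) * exp (c / 2 * (\<Sum>i<n. (?l * \<theta> i)\<^sup>2))"
    using mgf_walk[OF assms(1), of "\<lambda>i. ?l * \<theta> i"] by simp
  also have "\<dots> = exp (- (?l * r) + c / 2 * (?l\<^sup>2 * (\<Sum>i<n. (\<theta> i)\<^sup>2)))"
    by (simp only: exp_add power_mult_distrib sum_distrib_left)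
  also have "\<dots> \<le> exp (- (?l * r) + c / 2 * (?l\<^sup>2 * 1))"
    unfolding exp_le_cancel_iff
    using \<theta> c_ge_1 by (intro add_left_mono mult_left_mono) auto
  also have "- (?l * r) + c / 2 * (?l\<^sup>2 * 1) = - (r\<^sup>2 / (2 * c))"
    using c_ge_1 by (simp add: field_simps power2_eq_square)
  finally show ?thesis .
qed

lemma two_sided_tail:
  assumes "k \<le> t" and \<theta>: "(\<Sum>i<n. (\<theta> i)\<^sup>2) \<le> 1" and "0 \<le> r"
  shows "measure_pmf.prob (walk_upto k) {x. tame k x \<and> r < \<bar>\<Sum>i<n. \<theta> i * row_sum x i\<bar>}
    \<le> 2 * exp (- (r\<^sup>2 / (2 * c)))"
proof -
  have eq: "{x. tame k x \<and> r < \<bar>\<Sum>i<n. \<theta> i * row_sum x i\<bar>} =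
      {x. tame k x \<and> r < (\<Sum>i<n. \<theta> i * row_sum x i)} \<union>
      {x. tame k x \<and> r < (\<Sum>i<n. - \<theta> i * row_sum x i)}"
    by (auto simp: sum_negf)
  have "measure_pmf.prob (walk_upto k) {x. tame k x \<and> r < \<bar>\<Sum>i<n. \<theta> i * row_sum x i\<bar>} \<le>
      measure_pmf.prob (walk_upto k) {x. tame k x \<and> r < (\<Sum>i<n. \<theta> i * row_sum x i)} +
      measure_pmf.prob (walk_upto k) {x. tame k x \<and> r < (\<Sum>i<n. - \<theta> i * row_sum x i)}"
    unfolding eq by (rule measure_Un_le) auto
  also have "\<dots> \<le> exp (- (r\<^sup>2 / (2 * c))) + exp (- (r\<^sup>2 / (2 * c)))"
    using assms upper_tail[of k \<theta> r] upper_tail[of k "\<lambda>i. - \<theta> i" r] by (intro add_mono) auto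
  finally show ?thesis by simp
qed

text \<open>The first clamping at column \<open>k\<close> means that the inner product of this
  column with a still tame sum exceeds \<open>c\<close>. The tail bound with the column itself as
  test vector and \<open>r = c\<close> gives \<open>2 * exp (- (c / 2))\<close> per column.\<close>

lemma prob_not_tame:
  assumes "k \<le> t"
  shows "measure_pmf.prob (walk_upto k) {x. \<not> tame k x} \<le> 2 * real k * exp (- (c / 2))"
  using assms
proof (induction k)
  case 0
  show ?case by (simp add: tame_def)
next
  case (Suc k)
  have "measure_pmf.prob (walk_upto (Suc k)) {x. \<not> tame (Suc k) x} =
      measure_pmf.expectation (walk_upto (Suc k)) (\<lambda>x. of_bool (\<not> tame (Suc k) x))"
    by (rule expectation_of_bool[symmetric])
  also have "\<dots> \<le> measure_pmf.expectation (walk_upto k) (\<lambda>x. of_bool (\<not> (tame k x \<and> \<bar>drift k x\<bar> \<le> c)))"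
    unfolding walk_upto_Suc
  proof (rule expectation_bind_le)
    fix x assume "x \<in> set_pmf (walk_upto k)"
    hence x: "reachable k x" by (rule reachable_walk_upto)
    show "measure_pmf.expectation (walk_step k x) (\<lambda>x. of_bool (\<not> tame (Suc k) x))
        \<le> (of_bool (\<not> (tame k x \<and> \<bar>drift k x\<bar> \<le> c)) :: real)"
    proof (cases "tame k x \<and> \<bar>drift k x\<bar> \<le> c")
      case True
      hence "set_pmf (walk_step k x) \<inter> {x. \<not> tame (Suc k) x} = {}"
        by (auto simp: walk_step_def tame_Suc[OF x] tame_Suc_upd[OF x])
      hence "measure_pmf.prob (walk_step k x) {x. \<not> tame (Suc k) x} = 0"
        by (simp only: measure_pmf_zero_iff)
      thus ?thesis unfolding expectation_of_bool by simp
    qed (unfold expectation_of_bool, simp)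
  qed auto
  also have "\<dots> = measure_pmf.prob (walk_upto k) {x. \<not> (tame k x \<and> \<bar>drift k x\<bar> \<le> c)}"
    by (rule expectation_of_bool)
  also have "{x. \<not> (tame k x \<and> \<bar>drift k x\<bar> \<le> c)} =
      {x. \<not> tame k x} \<union> {x. tame k x \<and> c < \<bar>\<Sum>i<n. a i k * row_sum x i\<bar>}"
    by (auto simp: drift_def)
  also have "measure_pmf.prob (walk_upto k) \<dots> \<le> measure_pmf.prob (walk_upto k) {x. \<not> tame k x} +
      measure_pmf.prob (walk_upto k) {x. tame k x \<and> c < \<bar>\<Sum>i<n. a i k * row_sum x i\<bar>}"
    by (rule measure_Un_le) auto
  also have "\<dots> \<le> 2 * real k * exp (- (c / 2)) + 2 * exp (- (c\<^sup>2 / (2 * c)))"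
    using Suc unit_cols[of k] c_ge_1 by (intro add_mono two_sided_tail) auto
  also have "\<dots> = 2 * real (Suc k) * exp (- (c / 2))"
    using c_ge_1 by (simp add: power2_eq_square algebra_simps)
  finally show ?case .
qed

lemma reachable_bound: "reachable k x \<Longrightarrow> \<bar>x j\<bar> \<le> of_bool (\<not> zero_col j)"
  unfolding reachable_def by (cases "j < k") (auto split: if_splits)

text \<open>The drift is a signed sum of inner products of columns, each at most 1 in absolute value
  by Cauchy-Schwarz, and zero columns contribute nothing.\<close>

lemma drift_le:
  assumes "j < t" "reachable k x"
  shows "\<bar>drift j x\<bar> \<le> real (card {j. j < t \<and> \<not> zero_col j})"
proof -
  have "drift j x = (\<Sum>j'<t. x j' * (\<Sum>i<n. a i j * a i j'))"
    unfolding drift_def row_sum_def sum_distrib_left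
    by (subst sum.swap) (simp add: mult_ac)
  also have "\<bar>\<dots>\<bar> \<le> (\<Sum>j'<t. \<bar>x j' * (\<Sum>i<n. a i j * a i j')\<bar>)"
    by (rule sum_abs)
  also have "\<dots> \<le> (\<Sum>j'<t. of_bool (\<not> zero_col j'))"
  proof (rule sum_mono)
    fix j' assume j': "j' \<in> {..<t}"
    have "(\<Sum>i<n. a i j * a i j')\<^sup>2 \<le> (\<Sum>i<n. (a i j)\<^sup>2) * (\<Sum>i<n. (a i j')\<^sup>2)"
      by (rule Cauchy_Schwarz_ineq_sum)
    also have "\<dots> \<le> 1 * 1"
      using unit_cols assms j' by (intro mult_mono) (auto intro: sum_nonneg)
    finally have "\<bar>\<Sum>i<n. a i j * a i j'\<bar> \<le> 1"
      by (simp add: abs_square_le_1)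
    hence "\<bar>x j'\<bar> * \<bar>\<Sum>i<n. a i j * a i j'\<bar> \<le> of_bool (\<not> zero_col j') * 1"
      using reachable_bound[OF assms(2), of j'] by (intro mult_mono) auto
    thus "\<bar>x j' * (\<Sum>i<n. a i j * a i j')\<bar> \<le> of_bool (\<not> zero_col j')"
      by (simp add: abs_mult)
  qed
  also have "\<dots> = real (card {j. j < t \<and> \<not> zero_col j})"
    by (simp add: sum.If_cases of_bool_def Int_def)
  finally show ?thesis .
qed

text \<open>A deterministic replacement for \<open>prob_not_tame\<close>, for the case that the
  doubling was cut off.\<close>

lemma tame_if_few_columns:
  assumes "real (card {j. j < t \<and> \<not> zero_col j}) \<le> c" "k \<le> t" "reachable k x"
  shows "tame k x"
  unfolding tame_def
proof safe
  fix j assume j: "j < k"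
  have "i < k" if "i < j" for i using that j by simp
  hence "reachable j (\<lambda>i. if i < j then x i else 0)"
    using assms(3) unfolding reachable_def by (metis not_le)
  with j assms show "\<bar>drift j (\<lambda>i. if i < j then x i else 0)\<bar> \<le> c"
    using drift_le[of j j] by force
qed

text \<open>A union bound over the rows on the tame event, with the standard unit vectors as test
  vectors.\<close>

lemma prob_row_sums:
  assumes "0 \<le> r"
  shows "measure_pmf.prob (walk_upto t) {x. \<exists>i<n. r < \<bar>row_sum x i\<bar>} \<le>
    measure_pmf.prob (walk_upto t) {x. \<not> tame t x} + 2 * real n * exp (- (r\<^sup>2 / (2 * c)))"
proof -
  let ?B = "\<lambda>i. {x. tame t x \<and> r < \<bar>row_sum x i\<bar>}"
  have "measure_pmf.prob (walk_upto t) {x. \<exists>i<n. r < \<bar>row_sum x i\<bar>} \<le>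
      measure_pmf.prob (walk_upto t) ({x. \<not> tame t x} \<union> (\<Union>i<n. ?B i))"
    by (intro measure_pmf.finite_measure_mono) auto
  also have "\<dots> \<le> measure_pmf.prob (walk_upto t) {x. \<not> tame t x} +
      measure_pmf.prob (walk_upto t) (\<Union>i<n. ?B i)"
    by (rule measure_Un_le) auto
  also have "measure_pmf.prob (walk_upto t) (\<Union>i<n. ?B i) \<le>
      (\<Sum>i<n. measure_pmf.prob (walk_upto t) (?B i))"
    by (rule measure_pmf.finite_measure_subadditive_finite) auto
  also have "\<dots> \<le> (\<Sum>i<n. 2 * exp (- (r\<^sup>2 / (2 * c))))"
  proof (rule sum_mono)
    fix i assume i: "i \<in> {..<n}"
    have "(\<Sum>i'<n. (of_bool (i' = i))\<^sup>2) = (1 :: real)"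
      "(\<Sum>i'<n. of_bool (i' = i) * row_sum x i') = row_sum x i" for x
      using i by (simp_all add: of_bool_def if_distrib[of "\<lambda>u. u\<^sup>2"] if_distrib[of "\<lambda>u. u * _"] cong: if_cong)
    with two_sided_tail[of t "\<lambda>i'. of_bool (i' = i)" r] assms
    show "measure_pmf.prob (walk_upto t) (?B i) \<le> 2 * exp (- (r\<^sup>2 / (2 * c)))" by simp
  qed
  finally show ?thesis by simp
qed

end

section \<open>Composing executions with deterministic running time\<close>

text \<open>
  The continuation \<open>Q\<close> is universally quantified so that executions compose; the running time
  \<open>T\<close> is exact, so it must not depend on the coin tosses.
\<close>

definition exec :: "nat \<Rightarrow> prog \<Rightarrow> memory \<Rightarrow> ('a \<Rightarrow> memory \<Rightarrow> bool) \<Rightarrow> 'a pmf \<Rightarrow> bool" where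
  "exec T P s R D \<longleftrightarrow> (\<forall>Q. rel_pmf (\<lambda>a (Q', s'). Q' = Q \<and> R a s') D (run T (P @ Q, s)))"

abbreviation exec_det :: "nat \<Rightarrow> prog \<Rightarrow> memory \<Rightarrow> (memory \<Rightarrow> bool) \<Rightarrow> bool" where
  "exec_det T P s I \<equiv> exec T P s (\<lambda>_ :: unit. I) (return_pmf ())"

lemma run_add: "run (T + T') cfg = bind_pmf (run T cfg) (run T')"
  by (induction T arbitrary: cfg) (auto simp: bind_return_pmf bind_assoc_pmf intro!: bind_pmf_cong)

lemma run_halted: "run T ([], s) = return_pmf ([], s)"
  by (induction T) (auto simp: bind_return_pmf)

lemma exec_Nil: "R x s \<Longrightarrow> exec 0 [] s R (return_pmf x)"
  by (simp add: exec_def)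

text \<open>Couplings compose along \<open>bind_pmf\<close>, provided that the second part takes the
  same time \<open>T'\<close> after every outcome of the first.\<close>

lemma exec_append:
  assumes "exec T P s R D" "\<And>x s'. R x s' \<Longrightarrow> exec T' P' s' R' (F x)"
  shows "exec (T + T') (P @ P') s R' (bind_pmf D F)"
  unfolding exec_def run_add
proof
  fix Q
  have "rel_pmf (\<lambda>x (Q', s'). Q' = P' @ Q \<and> R x s') D (run T ((P @ P') @ Q, s))"
    using assms(1) by (simp add: exec_def)
  thus "rel_pmf (\<lambda>x (Q', s'). Q' = Q \<and> R' x s') (bind_pmf D F)
      (bind_pmf (run T ((P @ P') @ Q, s)) (run T'))"
    by (rule rel_pmf_bindI) (use assms(2) in \<open>auto simp: exec_def\<close>)
qed

lemma exec_det_append: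
  assumes "exec_det T P s I" "\<And>s'. I s' \<Longrightarrow> exec T' P' s' R D"
  shows "exec (T + T') (P @ P') s R D"
  using exec_append[of T P s "\<lambda>_. I" "return_pmf ()" T' P' R "\<lambda>_. D"] assms
  by (simp add: bind_return_pmf)

fun is_det :: "instr \<Rightarrow> bool" where
  "is_det (Flip _ _) = False"
| "is_det (Cond _ _ _) = False"
| "is_det (Loop _ _) = False"
| "is_det _ = True"

text \<open>The last equation is a dummy; \<open>det\<close> describes the machine only for
  instructions satisfying \<open>is_det\<close>.\<close>

fun det :: "instr \<Rightarrow> memory \<Rightarrow> memory" where
  "det (NConst x k) s = set_nvar x k s"
| "det (NAdd x y z) s = set_nvar x (nvar s y + nvar s z) s"
| "det (NSub x y z) s = set_nvar x (nvar s y - nvar s z) s"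
| "det (NLoad x a i) s = set_nvar x (narr s a (nvar s i)) s"
| "det (NStore a i x) s = set_narr a (nvar s i) (nvar s x) s"
| "det (RConst x q) s = set_rvar x (real_of_rat q) s"
| "det (RCast x y) s = set_rvar x (real (nvar s y)) s"
| "det (RAdd x y z) s = set_rvar x (rvar s y + rvar s z) s"
| "det (RSub x y z) s = set_rvar x (rvar s y - rvar s z) s"
| "det (RMul x y z) s = set_rvar x (rvar s y * rvar s z) s"
| "det (RDiv x y z) s = set_rvar x (rvar s y / rvar s z) s"
| "det (RLoad x a i) s = set_rvar x (rarr s a (nvar s i)) s"
| "det (RStore a i x) s = set_rarr a (nvar s i) (rvar s x) s"
| "det _ s = s"

lemma step_det: "is_det I \<Longrightarrow> step (I # Q, s) = return_pmf (Q, det I s)"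
  by (cases I) auto

lemma exec_straight:
  "list_all is_det P \<Longrightarrow> I (fold det P s) \<Longrightarrow> exec_det (length P) P s I"
  by (induction P arbitrary: s) (auto simp: exec_def step_det bind_return_pmf)

lemma exec_Flip:
  "(\<And>b. R b (set_nvar x (of_bool b) s)) \<Longrightarrow> exec 1 [Flip x p] s R (bernoulli_pmf (rvar s p))"
proof -
  assume R: "\<And>b. R b (set_nvar x (of_bool b) s)"
  have *: "run 0 = return_pmf" by (simp add: fun_eq_iff)
  show ?thesis
    by (simp add: exec_def * bind_return_pmf' pmf.rel_map R rel_pmf_reflI del: run.simps(1))
qed

lemma exec_Cond:
  "exec T (if holds b s then P1 else P2) s R D \<Longrightarrow> exec (Suc T) [Cond b P1 P2] s R D"
  by (simp add: exec_def bind_return_pmf)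

lemma exec_Loop_True:
  "holds b s \<Longrightarrow> exec T (P @ [Loop b P]) s R D \<Longrightarrow> exec (Suc T) [Loop b P] s R D"
  by (simp add: exec_def bind_return_pmf)

lemma exec_Loop_False: "\<not> holds b s \<Longrightarrow> R x s \<Longrightarrow> exec 1 [Loop b P] s R (return_pmf x)"
  by (simp add: exec_def bind_return_pmf)

text \<open>Each of the \<open>N\<close> rounds pays one unit for its test in addition to the body;
  the final \<open>+ 1\<close> is the failing test.\<close>

lemma exec_Loop:
  assumes "\<And>p s. p < N \<Longrightarrow> I p s \<Longrightarrow> holds b s \<and> exec_det T P s (I (Suc p))"
    and "\<And>s. I N s \<Longrightarrow> \<not> holds b s" and "I 0 s"
  shows "exec_det (N * Suc T + 1) [Loop b P] s (I N)"
proof -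
  have "exec_det ((N - p) * Suc T + 1) [Loop b P] s (I N)" if "p \<le> N" "I p s" for p s
    using that
  proof (induction "N - p" arbitrary: p s)
    case 0
    thus ?case using assms(2) exec_Loop_False[of b s "\<lambda>_. I N" "()" P] by simp
  next
    case (Suc k)
    have p: "p < N" using Suc by simp
    have "exec_det (T + ((N - Suc p) * Suc T + 1)) (P @ [Loop b P]) s (I N)"
      by (rule exec_det_append[of _ _ _ "I (Suc p)"])
        (use assms(1)[OF p] Suc in \<open>auto intro!: Suc.hyps(1)\<close>)
    moreover have "Suc (T + ((N - Suc p) * Suc T + 1)) = (N - p) * Suc T + 1"
      using p by (metis Suc_diff_Suc add.assoc add_Suc mult_Suc)
    ultimately show ?case
      using exec_Loop_True assms(1)[OF p Suc.prems(2)] by metis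
  qed
  from this[of 0 s] assms(3) show ?thesis by simp
qed

text \<open>With the empty continuation the machine has halted after \<open>T\<close> steps, and a
  halted configuration never changes.\<close>

lemma exec_run_longer:
  assumes "exec T P s R D" "T \<le> T'"
  shows "rel_pmf (\<lambda>x (Q', s'). Q' = [] \<and> R x s') D (run T' (P, s))"
proof -
  have *: "rel_pmf (\<lambda>x (Q', s'). Q' = [] \<and> R x s') D (run T (P, s))"
    using assms(1) unfolding exec_def by (metis append_Nil2)
  have "rel_pmf (\<lambda>x (Q', s'). Q' = [] \<and> R x s') (bind_pmf D return_pmf)
      (bind_pmf (run T (P, s)) (run (T' - T)))"
    by (rule rel_pmf_bindI[OF *]) (auto simp: run_halted)
  thus ?thesis using assms(2) by (simp add: bind_return_pmf' flip: run_add)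
qed

lemma exec_halts_within:
  assumes "exec T P s R D" "T \<le> T'"
  shows "halts_within P s T'"
  using rel_pmf_imp_rel_set[OF exec_run_longer[OF assms]]
  by (auto simp: halts_within_def rel_set_def)

text \<open>When the coupling relation determines the observed value, the coupling becomes an
  equality of distributions.\<close>

lemma exec_output:
  assumes "exec T P s R D" "T \<le> T'" "\<And>x s'. R x s' \<Longrightarrow> g x = f s'"
  shows "map_pmf (\<lambda>(_, s'). f s') (run T' (P, s)) = map_pmf g D"
proof -
  have "rel_pmf (\<lambda>x y. g x = (case y of (_, s') \<Rightarrow> f s')) D (run T' (P, s))"
    by (rule pmf.rel_mono_strong[OF exec_run_longer[OF assms(1,2)]]) (use assms(3) in auto)
  hence "rel_pmf (=) (map_pmf g D) (map_pmf (\<lambda>(_, s'). f s') (run T' (P, s)))"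
    by (simp add: pmf.rel_map)
  thus ?thesis by (simp add: pmf.rel_eq)
qed

section \<open>The layout of the nonzero entries\<close>

definition nz_rows :: "real mat \<Rightarrow> nat \<Rightarrow> nat list" where
  "nz_rows A j = filter (\<lambda>i. A $$ (i, j) \<noteq> 0) [0..<dim_row A]"

text \<open>The position in \<open>nz_positions A\<close> where the block of column \<open>j\<close>
  begins.\<close>

definition offset :: "real mat \<Rightarrow> nat \<Rightarrow> nat" where
  "offset A j = (\<Sum>j'<j. length (nz_rows A j'))"

lemma set_nz_rows: "set (nz_rows A j) = {i. i < dim_row A \<and> A $$ (i, j) \<noteq> 0}"
  by (auto simp: nz_rows_def)

lemma distinct_nz_rows: "distinct (nz_rows A j)"
  by (simp add: nz_rows_def)

lemma offset_Suc: "offset A (Suc j) = offset A j + length (nz_rows A j)"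
  by (simp add: offset_def)

lemma offset_mono: "j \<le> j' \<Longrightarrow> offset A j \<le> offset A j'"
  unfolding offset_def by (rule sum_mono2) auto

lemma nz_positions_rows: "nz_positions A = concat (map (\<lambda>j. map (\<lambda>i. (i, j)) (nz_rows A j)) [0..<dim_col A])"
proof -
  have "concat (map (\<lambda>i. if P i then [f i] else []) xs) = map f (filter P xs)"
    for P and f :: "nat \<Rightarrow> nat \<times> nat" and xs
    by (induction xs) auto
  thus ?thesis unfolding nz_positions_def nz_rows_def by simp
qed

lemma length_concat_upt: "length (concat (map f [0..<t])) = (\<Sum>j<t. length (f j))"
  by (induction t) auto

lemma nth_concat_upt:
  assumes "j < t" "p < length (f j)"
  shows "concat (map f [0..<t]) ! ((\<Sum>j'<j. length (f j')) + p) = f j ! p"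
  using assms
proof (induction t)
  case (Suc t)
  have "(\<Sum>j'<j. length (f j')) + p < (\<Sum>j'<t. length (f j'))" if "j < t"
  proof -
    have "(\<Sum>j'<Suc j. length (f j')) \<le> (\<Sum>j'<t. length (f j'))"
      using that by (intro sum_mono2) auto
    thus ?thesis using Suc.prems by simp
  qed
  thus ?case using Suc
    by (cases "j = t") (auto simp: nth_append length_concat_upt)
qed simp

lemma nth_nz_positions:
  assumes "j < dim_col A" "p < length (nz_rows A j)"
  shows "nz_positions A ! (offset A j + p) = (nz_rows A j ! p, j)"
  using nth_concat_upt[of j "dim_col A" p "\<lambda>j. map (\<lambda>i. (i, j)) (nz_rows A j)"] assms
  by (simp add: nz_positions_rows offset_def)

lemma offset_dim_col: "offset A (dim_col A) = nnz A"
  by (simp add: offset_def nz_positions_rows length_concat_upt flip: length_nz_positions)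

lemma sum_rows: "(\<Sum>p<length (nz_rows A j). A $$ (nz_rows A j ! p, j) * f (nz_rows A j ! p)) =
  (\<Sum>i<dim_row A. A $$ (i, j) * f i)"
proof -
  have "(\<Sum>p<length (nz_rows A j). A $$ (nz_rows A j ! p, j) * f (nz_rows A j ! p)) =
      (\<Sum>i\<in>set (nz_rows A j). A $$ (i, j) * f i)"
    using bij_betw_nth[OF distinct_nz_rows refl refl, of A j]
    by (intro sum.reindex_bij_betw) auto
  also have "\<dots> = (\<Sum>i<dim_row A. A $$ (i, j) * f i)"
    by (rule sum.mono_neutral_left) (auto simp: set_nz_rows)
  finally show ?thesis .
qed

section \<open>The program\<close>

text \<open>
  Natural variables: 3 is the position in the list of nonzero entries, 4 and 6 are \<open>2^l\<close> and \<open>l\<close> for the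
  scale \<open>l\<close>, 5 holds the constant 1, 7 is the current column plus one, 8 the column of the entry under the
  scanning position, 9 its row, 10 the scanning position of the first pass over a column, 11 the coin,
  12 the current column; 13 is never written and stays 0.  Real variables: 0 holds \<open>2c\<close>, 1 the inner
  product, 4 the probability of sign 1, 5 the sign, 6 and 7 the constants 1/2 and 1.  Real array 2 is \<open>w\<close>.
\<close>

definition dot_body :: prog where
  "dot_body = [NLoad 9 0 10, RLoad 2 0 10, RLoad 3 2 9, RMul 3 2 3, RAdd 1 1 3, NAdd 10 10 5, NLoad 8 1 10]"

definition update_body :: prog where
  "update_body = [NLoad 9 0 3, RLoad 2 0 3, RLoad 3 2 9, RMul 2 2 5, RAdd 3 3 2, RStore 2 9 3, NAdd 3 3 5, NLoad 8 1 3]"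

text \<open>Adding variable 13, which is 0, serves as a copy instruction.\<close>

definition column_start :: prog where
  "column_start = [NLoad 12 1 3, NAdd 7 12 5, NAdd 10 3 13, NAdd 8 12 13, RConst 1 0]"

definition column_bias :: prog where
  "column_bias = [RDiv 4 1 0, RSub 4 6 4]"

definition column_sign :: prog where
  "column_sign = [RCast 5 11, RAdd 5 5 5, RSub 5 5 7, RStore 1 12 5, NAdd 8 12 13]"

text \<open>Two passes over the block of one column: the first computes the inner product and leaves
  variable 3 at the start of the block, the second adds the signed column to \<open>w\<close> and
  advances variable 3.\<close>

definition column_body :: prog where
  "column_body = column_start @ [Loop (NLess 8 7) dot_body] @ column_bias @ [Flip 11 4] @
     column_sign @ [Loop (NLess 8 7) update_body]"

text \<open>The two assignments to variable 14 are padding: both branches must take the same time.\<close>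

definition scale_body :: prog where
  "scale_body = [Cond (NLess 4 1) [NAdd 4 4 4, NAdd 6 6 5] [NConst 14 0, NConst 14 0]] @ [NAdd 3 3 5]"

definition prog_start :: prog where
  "prog_start = [NConst 5 1, NConst 4 2, NConst 6 1]"

text \<open>
  \<open>NStore 1 2 1\<close> appends \<open>t\<close> to the list of column indices, a sentinel that ends the scan of the last
  nonzero column.
\<close>

definition prog_setup :: "nat \<Rightarrow> prog" where
  "prog_setup K = [RConst 0 (of_nat (4 * (K + 3))), RCast 1 6, RMul 0 0 1, RConst 6 (1 / 2), RConst 7 1,
     NStore 1 2 1, NConst 3 0]"

definition balance_prog :: "nat \<Rightarrow> prog" where
  "balance_prog K = prog_start @ [Loop (NLess 3 2) scale_body] @ prog_setup K @ [Loop (NLess 3 2) column_body]"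

lemmas mem_simps = set_nvar_def set_rvar_def set_narr_def set_rarr_def

section \<open>Loop invariants coupling the program with the walk\<close>

locale matrix_walk =
  fixes A :: "real mat" and c :: real
begin

sublocale balancing_walk "\<lambda>i j. A $$ (i, j)" "dim_row A" "dim_col A" c .

lemma zero_col_iff: "zero_col j \<longleftrightarrow> nz_rows A j = []"
  by (auto simp: zero_col_def nz_rows_def filter_empty_conv)

text \<open>The last conjunct ends the scan of column \<open>j\<close>: behind its block comes an
  entry of a later column or the sentinel.\<close>

definition stored :: "memory \<Rightarrow> bool" where
  "stored s \<longleftrightarrow> nvar s 2 = nnz A \<and> nvar s 5 = 1 \<and> nvar s 13 = 0 \<and>
     rvar s 0 = 2 * c \<and> rvar s 6 = 1 / 2 \<and> rvar s 7 = 1 \<and>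
     (\<forall>j<dim_col A. \<forall>p<length (nz_rows A j). narr s 0 (offset A j + p) = nz_rows A j ! p \<and>
        narr s 1 (offset A j + p) = j \<and> rarr s 0 (offset A j + p) = A $$ (nz_rows A j ! p, j)) \<and>
     (\<forall>j<dim_col A. j < narr s 1 (offset A (Suc j)))"

text \<open>Where no sign has been chosen, the output array still holds its initial 1.\<close>

definition written :: "(nat \<Rightarrow> real) \<Rightarrow> memory \<Rightarrow> bool" where
  "written x s \<longleftrightarrow> (\<forall>j<dim_col A. rarr s 1 j = (if x j = 0 then 1 else x j))"

definition walk_inv :: "nat \<Rightarrow> (nat \<Rightarrow> real) \<Rightarrow> memory \<Rightarrow> bool" where
  "walk_inv j x s \<longleftrightarrow> reachable j x \<and> stored s \<and> written x s \<and> nvar s 3 = offset A j \<and>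
     (\<forall>i<dim_row A. rarr s 2 i = row_sum x i)"

definition dot_inv :: "nat \<Rightarrow> (nat \<Rightarrow> real) \<Rightarrow> nat \<Rightarrow> memory \<Rightarrow> bool" where
  "dot_inv j x p s \<longleftrightarrow> walk_inv j x s \<and> nvar s 12 = j \<and> nvar s 7 = Suc j \<and>
     nvar s 10 = offset A j + p \<and> nvar s 8 = narr s 1 (offset A j + p) \<and>
     rvar s 1 = (\<Sum>p'<p. A $$ (nz_rows A j ! p', j) * row_sum x (nz_rows A j ! p'))"

definition update_inv :: "nat \<Rightarrow> (nat \<Rightarrow> real) \<Rightarrow> real \<Rightarrow> nat \<Rightarrow> memory \<Rightarrow> bool" where
  "update_inv j x e p s \<longleftrightarrow> stored s \<and> written (x(j := e)) s \<and> nvar s 7 = Suc j \<and>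
     nvar s 3 = offset A j + p \<and> nvar s 8 = narr s 1 (offset A j + p) \<and> rvar s 5 = e \<and>
     (\<forall>i<dim_row A. rarr s 2 i =
        row_sum x i + (if i \<in> set (take p (nz_rows A j)) then e * A $$ (i, j) else 0))"

lemma rows_nth_less: "p < length (nz_rows A j) \<Longrightarrow> nz_rows A j ! p < dim_row A"
  using nth_mem[of p "nz_rows A j"] by (simp add: set_nz_rows)

lemma exec_dot:
  assumes j: "j < dim_col A" and s: "dot_inv j x 0 s"
  shows "exec_det (length (nz_rows A j) * 8 + 1) [Loop (NLess 8 7) dot_body] s
    (dot_inv j x (length (nz_rows A j)))"
proof -
  have "exec_det (length (nz_rows A j) * Suc 7 + 1) [Loop (NLess 8 7) dot_body] s
    (dot_inv j x (length (nz_rows A j)))"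
  proof (rule exec_Loop)
    fix p s assume p: "p < length (nz_rows A j)" and I: "dot_inv j x p s"
    have a: "narr s 0 (offset A j + p) = nz_rows A j ! p" "narr s 1 (offset A j + p) = j"
      "rarr s 0 (offset A j + p) = A $$ (nz_rows A j ! p, j)"
      using I j p by (auto simp: dot_inv_def walk_inv_def stored_def)
    have w: "rarr s 2 (nz_rows A j ! p) = row_sum x (nz_rows A j ! p)"
      using I rows_nth_less[OF p] by (auto simp: dot_inv_def walk_inv_def)
    have "holds (NLess 8 7) s" using I a by (simp add: dot_inv_def)
    moreover have "exec_det (length dot_body) dot_body s (dot_inv j x (Suc p))"
    proof (rule exec_straight)
      show "dot_inv j x (Suc p) (fold det dot_body s)"
        using I a w
        by (simp add: dot_inv_def walk_inv_def stored_def written_def dot_body_def mem_simps)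
    qed (simp add: dot_body_def)
    moreover have "length dot_body = 7" by (simp add: dot_body_def)
    ultimately show "holds (NLess 8 7) s \<and> exec_det 7 dot_body s (dot_inv j x (Suc p))"
      by simp
  next
    fix s assume "dot_inv j x (length (nz_rows A j)) s"
    thus "\<not> holds (NLess 8 7) s"
      using j by (auto simp: dot_inv_def walk_inv_def stored_def not_less Suc_le_eq offset_Suc)
  qed (fact s)
  thus ?thesis by simp
qed

lemma exec_update:
  assumes j: "j < dim_col A" and s: "update_inv j x e 0 s"
  shows "exec_det (length (nz_rows A j) * 9 + 1) [Loop (NLess 8 7) update_body] s
    (update_inv j x e (length (nz_rows A j)))"
proof -
  have "exec_det (length (nz_rows A j) * Suc 8 + 1) [Loop (NLess 8 7) update_body] s
    (update_inv j x e (length (nz_rows A j)))"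
  proof (rule exec_Loop)
    fix p s assume p: "p < length (nz_rows A j)" and I: "update_inv j x e p s"
    have a: "narr s 0 (offset A j + p) = nz_rows A j ! p" "narr s 1 (offset A j + p) = j"
      "rarr s 0 (offset A j + p) = A $$ (nz_rows A j ! p, j)"
      using I j p by (auto simp: update_inv_def stored_def)
    \<comment> \<open>A row occurs only once in a block, so the entry of \<open>w\<close> read here
      has not yet been changed in this pass.\<close>
    have new: "nz_rows A j ! p \<notin> set (take p (nz_rows A j))"
      using p distinct_nz_rows[of A j] by (auto simp: in_set_conv_nth nth_eq_iff_index_eq)
    hence w: "rarr s 2 (nz_rows A j ! p) = row_sum x (nz_rows A j ! p)"
      using I rows_nth_less[OF p] by (auto simp: update_inv_def)
    have "holds (NLess 8 7) s" using I a by (simp add: update_inv_def)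
    moreover have "exec_det (length update_body) update_body s (update_inv j x e (Suc p))"
    proof (rule exec_straight)
      show "update_inv j x e (Suc p) (fold det update_body s)"
        using I a w p new
        by (simp add: update_inv_def stored_def written_def update_body_def mem_simps
            take_Suc_conv_app_nth)
    qed (simp add: update_body_def)
    moreover have "length update_body = 8" by (simp add: update_body_def)
    ultimately show "holds (NLess 8 7) s \<and> exec_det 8 update_body s (update_inv j x e (Suc p))"
      by simp
  next
    fix s assume "update_inv j x e (length (nz_rows A j)) s"
    thus "\<not> holds (NLess 8 7) s"
      using j by (auto simp: update_inv_def stored_def not_less Suc_le_eq offset_Suc)
  qed (fact s)
  thus ?thesis by simp
qed

text \<open>The block must be nonempty because the column index is read from its first entry. The
  time does not depend on the coin: 8 and 9 units per entry in the two passes, and 15 for the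
  straight code, the coin and the two failing tests.\<close>

lemma exec_column:
  assumes j: "j < dim_col A" and ne: "nz_rows A j \<noteq> []" and s: "walk_inv j x s"
  shows "exec (15 + 17 * length (nz_rows A j)) column_body s (walk_inv (Suc j)) (walk_step j x)"
proof -
  let ?L = "length (nz_rows A j)"
  have L: "0 < ?L" using ne by simp
  have xj: "x j = 0" and x: "reachable j x" using s by (auto simp: walk_inv_def reachable_def)
  define P where "P = bernoulli_pmf (1 / 2 - drift j x / (2 * c))"
  have start: "exec_det (length column_start) column_start s (dot_inv j x 0)"
  proof (rule exec_straight)
    have "narr s 1 (offset A j + 0) = j"
      using s j L unfolding walk_inv_def stored_def by blast
    thus "dot_inv j x 0 (fold det column_start s)"
      using s by (simp add: column_start_def dot_inv_def walk_inv_def stored_def written_def mem_simps)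
  qed (simp add: column_start_def)
  have bias: "exec_det (length column_bias) column_bias s
      (\<lambda>s. walk_inv j x s \<and> nvar s 12 = j \<and> nvar s 7 = Suc j \<and> rvar s 4 = 1 / 2 - drift j x / (2 * c))"
    if "dot_inv j x ?L s" for s
  proof (rule exec_straight)
    have "rvar s 1 = drift j x"
      using that by (simp add: dot_inv_def drift_def sum_rows)
    thus "walk_inv j x (fold det column_bias s) \<and> nvar (fold det column_bias s) 12 = j \<and>
        nvar (fold det column_bias s) 7 = Suc j \<and>
        rvar (fold det column_bias s) 4 = 1 / 2 - drift j x / (2 * c)"
      using that by (simp add: column_bias_def dot_inv_def walk_inv_def stored_def written_def mem_simps)
  qed (simp add: column_bias_def)
  have flip: "exec 1 [Flip 11 4] s (\<lambda>b s. walk_inv j x s \<and> nvar s 12 = j \<and> nvar s 7 = Suc j \<and>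
      nvar s 11 = of_bool b) P"
    if "walk_inv j x s \<and> nvar s 12 = j \<and> nvar s 7 = Suc j \<and> rvar s 4 = 1 / 2 - drift j x / (2 * c)" for s
  proof -
    have "P = bernoulli_pmf (rvar s 4)" using that by (simp add: P_def)
    moreover have "exec 1 [Flip 11 4] s (\<lambda>b s. walk_inv j x s \<and> nvar s 12 = j \<and> nvar s 7 = Suc j \<and>
      nvar s 11 = of_bool b) (bernoulli_pmf (rvar s 4))"
      by (rule exec_Flip) (use that in \<open>simp add: walk_inv_def stored_def written_def mem_simps\<close>)
    ultimately show ?thesis by simp
  qed
  have sign: "exec_det (length column_sign) column_sign s (update_inv j x (2 * of_bool b - 1) 0)"
    if "walk_inv j x s \<and> nvar s 12 = j \<and> nvar s 7 = Suc j \<and> nvar s 11 = of_bool b" for b s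
  proof (rule exec_straight)
    have "narr s 1 (offset A j + 0) = j"
      using that j L unfolding walk_inv_def stored_def by blast
    thus "update_inv j x (2 * of_bool b - 1) 0 (fold det column_sign s)"
      using that by (cases b)
        (simp_all add: column_sign_def update_inv_def walk_inv_def stored_def written_def mem_simps)
  qed (simp add: column_sign_def)
  have finish: "walk_inv (Suc j) (x(j := 2 * of_bool b - 1)) s"
    if "update_inv j x (2 * of_bool b - 1) ?L s" for b s
  proof -
    have "reachable (Suc j) (x(j := 2 * of_bool b - 1))"
      using x ne by (auto simp: reachable_def zero_col_iff less_Suc_eq)
    thus ?thesis
      using that row_sum_upd[of j x, OF j xj]
      by (auto simp: update_inv_def walk_inv_def offset_Suc set_nz_rows)
  qed
  have upd: "exec (?L * 9 + 1) [Loop (NLess 8 7) update_body] s (walk_inv (Suc j))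
      (return_pmf (x(j := 2 * of_bool b - 1)))"
    if "update_inv j x (2 * of_bool b - 1) 0 s" for b s
    using exec_append[OF exec_update[OF j that], of 0 "[]" "walk_inv (Suc j)"
        "\<lambda>_. return_pmf (x(j := 2 * of_bool b - 1))"] finish
    by (simp add: exec_Nil bind_return_pmf)
  have step: "walk_step j x = bind_pmf P (\<lambda>b. return_pmf (x(j := 2 * of_bool b - 1)))"
    using ne by (simp add: walk_step_def zero_col_iff P_def map_pmf_def)
  have "exec (length column_start + ((?L * 8 + 1) + (length column_bias + (1 +
      (length column_sign + (?L * 9 + 1)))))) column_body s (walk_inv (Suc j)) (walk_step j x)"
    unfolding column_body_def step
    by (intro exec_det_append[OF start] exec_det_append[OF exec_dot[OF j]] exec_det_append[OF bias]
        exec_append[OF flip] exec_det_append[OF sign] upd)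
  also have "length column_start + ((?L * 8 + 1) + (length column_bias + (1 +
      (length column_sign + (?L * 9 + 1))))) = 15 + 17 * ?L"
    by (simp add: column_start_def column_bias_def column_sign_def)
  finally show ?thesis .
qed

text \<open>Backward induction on the column. \<open>T\<close> is fixed before \<open>x\<close> and
  \<open>s\<close>, as composition needs a time common to all outcomes. A zero column costs no
  round: its block is empty, so the invariant for \<open>j\<close> is already the one for
  \<open>Suc j\<close>.\<close>

lemma exec_walk:
  assumes "j \<le> dim_col A"
  shows "\<exists>T. T + 33 * offset A j \<le> 33 * nnz A + 1 \<and> (\<forall>x s. walk_inv j x s \<longrightarrow>
    exec T [Loop (NLess 3 2) column_body] s (walk_inv (dim_col A)) (walk [j..<dim_col A] x))"
  using assms
proof (induction rule: inc_induct)
  case base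
  have "exec 1 [Loop (NLess 3 2) column_body] s (walk_inv (dim_col A)) (return_pmf x)"
    if "walk_inv (dim_col A) x s" for x s
    by (rule exec_Loop_False)
      (use that in \<open>auto simp: walk_inv_def stored_def offset_dim_col\<close>)
  thus ?case by (intro exI[of _ 1]) (simp add: offset_dim_col)
next
  case (step j)
  then obtain T where T: "T + 33 * offset A (Suc j) \<le> 33 * nnz A + 1"
    and ex: "\<And>x s. walk_inv (Suc j) x s \<Longrightarrow>
      exec T [Loop (NLess 3 2) column_body] s (walk_inv (dim_col A)) (walk [Suc j..<dim_col A] x)"
    by blast
  have upt: "[j..<dim_col A] = j # [Suc j..<dim_col A]"
    using step by (simp add: upt_conv_Cons)
  show ?case
  proof (cases "nz_rows A j = []")
    case True
    hence "walk_inv j x s \<Longrightarrow> walk_inv (Suc j) x s" for x s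
      by (auto simp: walk_inv_def offset_Suc reachable_def zero_col_iff less_Suc_eq)
    moreover have "walk_step j x = return_pmf x" for x
      using True by (simp add: walk_step_def zero_col_iff)
    ultimately show ?thesis using T ex True
      by (intro exI[of _ T]) (simp add: upt bind_return_pmf offset_Suc)
  next
    case False
    hence L: "1 \<le> length (nz_rows A j)" by (simp add: Suc_le_eq)
    have "offset A (Suc j) \<le> nnz A"
      using step offset_mono[of "Suc j" "dim_col A" A] by (simp add: offset_dim_col)
    hence lt: "offset A j < nnz A" using L by (simp add: offset_Suc)
    have "exec (Suc (15 + 17 * length (nz_rows A j) + T)) [Loop (NLess 3 2) column_body] s
        (walk_inv (dim_col A)) (walk [j..<dim_col A] x)" if I: "walk_inv j x s" for x s
    proof (rule exec_Loop_True)
      show "holds (NLess 3 2) s" using I lt by (simp add: walk_inv_def stored_def)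
      show "exec (15 + 17 * length (nz_rows A j) + T) (column_body @ [Loop (NLess 3 2) column_body]) s
          (walk_inv (dim_col A)) (walk [j..<dim_col A] x)"
        unfolding upt walk.simps
        by (rule exec_append[OF exec_column[OF _ False I] ex]) (use step in auto)
    qed
    \<comment> \<open>With \<open>L \<ge> 1\<close> entries in the block, the round costs
      \<open>16 + 17 * L \<le> 33 * L\<close>.\<close>
    thus ?thesis using T L
      by (intro exI[of _ "Suc (15 + 17 * length (nz_rows A j) + T)"]) (simp add: offset_Suc)
  qed
qed

end

section \<open>The doubling scale compared with the logarithm\<close>

primrec log_scale :: "nat \<Rightarrow> nat \<Rightarrow> nat" where
  "log_scale t 0 = 1"
| "log_scale t (Suc p) = (if 2 ^ log_scale t p < t then Suc (log_scale t p) else log_scale t p)"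

lemma scale_pos: "1 \<le> log_scale t p"
  by (induction p) auto

text \<open>The exponent grows in every round until the power reaches \<open>t\<close>: either no
  round was idle, or the doubling is complete.\<close>

lemma scale_cases: "log_scale t p = Suc p \<or> t \<le> 2 ^ log_scale t p"
  by (induction p) (auto simp: not_less)

lemma scale_minimal: "log_scale t p = 1 \<or> 2 ^ (log_scale t p - 1) < t"
  by (induction p) auto

text \<open>The power before the last doubling is below \<open>t\<close>, so the exponent exceeds
  the binary logarithm by at most 1. For \<open>t \<ge> 2\<close> this costs a factor 2, and
  \<open>ln 2 \<ge> 1 / 2\<close> another.\<close>

lemma scale_le_ln:
  assumes "2 \<le> t"
  shows "real (log_scale t p) \<le> 4 * ln (real t)"
proof -
  have ln2: "1 / 2 \<le> ln (2 :: real)" using ln2_ge_two_thirds by simp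
  have lnt: "ln 2 \<le> ln (real t)" using assms by simp
  have "real (log_scale t p) * ln 2 \<le> 2 * ln (real t)"
  proof (cases "log_scale t p = 1")
    case False
    with scale_minimal[of t p] have "2 ^ (log_scale t p - 1) < t" by simp
    hence "(2 :: real) ^ (log_scale t p - 1) \<le> real t"
      by (metis less_imp_le of_nat_le_iff of_nat_numeral of_nat_power)
    hence "ln ((2 :: real) ^ (log_scale t p - 1)) \<le> ln (real t)"
      using assms by (subst ln_le_cancel_iff) auto
    hence "real (log_scale t p - 1) * ln 2 \<le> ln (real t)"
      by (simp add: ln_realpow)
    thus ?thesis using scale_pos[of t p] lnt by (simp add: of_nat_diff algebra_simps)
  next
    case True
    have "ln 2 \<le> 2 * ln (real t)" using lnt ln2 by linarith
    with True show ?thesis by simp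
  qed
  moreover have "real (log_scale t p) * (1 / 2) \<le> real (log_scale t p) * ln 2"
    using ln2 by (intro mult_left_mono) auto
  ultimately show ?thesis by simp
qed

lemma ln_le_scale:
  assumes "1 \<le> t" "t \<le> 2 ^ log_scale t p"
  shows "ln (real t) \<le> real (log_scale t p)"
proof -
  have "real t \<le> 2 ^ log_scale t p"
    using assms(2) by (metis of_nat_le_iff of_nat_numeral of_nat_power)
  hence "ln (real t) \<le> ln (2 ^ log_scale t p)"
    using assms(1) by (subst ln_le_cancel_iff) auto
  also have "\<dots> = real (log_scale t p) * ln 2" by (simp add: ln_realpow)
  also have "\<dots> \<le> real (log_scale t p) * 1"
    using ln_le_minus_one[of "2 :: real"] by (intro mult_left_mono) auto
  finally show ?thesis by simp
qed

text \<open>Zero columns do not move the offset, so the entry found at \<open>offset A j\<close>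
  belongs to the first nonzero column from \<open>j\<close> on.\<close>

lemma next_column:
  assumes "j \<le> dim_col A" "offset A j < nnz A"
  shows "\<exists>j'\<ge>j. j' < dim_col A \<and> offset A j' = offset A j \<and> nz_rows A j' \<noteq> []"
  using assms
proof (induction rule: inc_induct)
  case base
  thus ?case by (simp add: offset_dim_col)
next
  case (step j)
  show ?case
  proof (cases "nz_rows A j = []")
    case True
    with step show ?thesis by (auto simp: offset_Suc dest: Suc_leD)
  qed (use step in auto)
qed

section \<open>The set-up phase and the whole program\<close>

definition scale_inv :: "real mat \<Rightarrow> nat \<Rightarrow> memory \<Rightarrow> bool" where
  "scale_inv A p s \<longleftrightarrow> nvar s 1 = dim_col A \<and> nvar s 2 = nnz A \<and> nvar s 3 = p \<and>
     nvar s 4 = 2 ^ log_scale (dim_col A) p \<and> nvar s 5 = 1 \<and> nvar s 6 = log_scale (dim_col A) p \<and>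
     nvar s 13 = 0 \<and> narr s 0 = narr (input_memory A) 0 \<and> narr s 1 = narr (input_memory A) 1 \<and>
     rarr s 0 = rarr (input_memory A) 0 \<and> rarr s 1 = rarr (input_memory A) 1 \<and> rarr s 2 = (\<lambda>_. 0)"

lemma exec_scale:
  assumes "scale_inv A 0 s"
  shows "exec_det (nnz A * 5 + 1) [Loop (NLess 3 2) scale_body] s (scale_inv A (nnz A))"
proof -
  have "exec_det (nnz A * Suc 4 + 1) [Loop (NLess 3 2) scale_body] s (scale_inv A (nnz A))"
  proof (rule exec_Loop)
    fix p s assume p: "p < nnz A" and I: "scale_inv A p s"
    \<comment> \<open>Between the branching and the increment, the next invariant holds except for
      the counter, variable 3.\<close>
    let ?I = "\<lambda>s. scale_inv A (Suc p) (set_nvar 3 (Suc p) s) \<and> nvar s 3 = p \<and> nvar s 5 = 1"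
    have "exec_det (Suc 2)
        [Cond (NLess 4 1) [NAdd 4 4 4, NAdd 6 6 5] [NConst 14 0, NConst 14 0]] s ?I"
    proof (rule exec_Cond)
      let ?Q = "if holds (NLess 4 1) s then [NAdd 4 4 4, NAdd 6 6 5] else [NConst 14 0, NConst 14 0]"
      have "exec_det (length ?Q) ?Q s ?I"
        by (rule exec_straight) (use I in \<open>auto simp: scale_inv_def mem_simps\<close>)
      moreover have "length ?Q = 2" by simp
      ultimately show "exec_det 2 ?Q s ?I" by simp
    qed
    hence "exec_det (Suc 2 + length [NAdd 3 3 5]) scale_body s (scale_inv A (Suc p))"
      unfolding scale_body_def by (rule exec_det_append) (rule exec_straight; simp)
    moreover have "holds (NLess 3 2) s" using I p by (simp add: scale_inv_def)
    ultimately show "holds (NLess 3 2) s \<and> exec_det 4 scale_body s (scale_inv A (Suc p))"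
      by (simp add: numeral_eq_Suc)
  qed (use assms in \<open>auto simp: scale_inv_def\<close>)
  thus ?thesis by simp
qed

context matrix_walk
begin

lemma walk_inv_start:
  assumes c: "c = 2 * (real K + 3) * real (log_scale (dim_col A) (nnz A))" and I: "scale_inv A (nnz A) s"
  shows "walk_inv 0 (\<lambda>_. 0) (fold det (prog_setup K) s)"
proof -
  let ?s = "fold det (prog_setup K) s"
  have entry: "narr ?s 0 (offset A j + p) = nz_rows A j ! p" "narr ?s 1 (offset A j + p) = j"
    "rarr ?s 0 (offset A j + p) = A $$ (nz_rows A j ! p, j)"
    if "j < dim_col A" "p < length (nz_rows A j)" for j p
  proof -
    have "offset A (Suc j) \<le> nnz A"
      using that offset_mono[of "Suc j" "dim_col A" A] by (simp add: offset_dim_col)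
    hence "offset A j + p < nnz A" using that by (simp add: offset_Suc)
    thus "narr ?s 0 (offset A j + p) = nz_rows A j ! p" "narr ?s 1 (offset A j + p) = j"
      "rarr ?s 0 (offset A j + p) = A $$ (nz_rows A j ! p, j)"
      using I nth_nz_positions[OF that]
      by (simp_all add: scale_inv_def prog_setup_def mem_simps input_memory_def length_nz_positions Let_def)
  qed
  \<comment> \<open>Behind the last block stands the sentinel \<open>dim_col A\<close>; behind any
    other, the index of a later nonzero column.\<close>
  have sentinel: "j < narr ?s 1 (offset A (Suc j))" if j: "j < dim_col A" for j
  proof (cases "offset A (Suc j) = nnz A")
    case True
    thus ?thesis using I that by (simp add: scale_inv_def prog_setup_def mem_simps)
  next
    case False
    hence "offset A (Suc j) < nnz A"
      using that offset_mono[of "Suc j" "dim_col A" A] by (simp add: offset_dim_col)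
    then obtain j' where "Suc j \<le> j'" "j' < dim_col A" "offset A j' = offset A (Suc j)" "nz_rows A j' \<noteq> []"
      using next_column[of "Suc j" A] j by (auto simp: Suc_le_eq)
    thus ?thesis using entry(2)[of j' 0] by simp
  qed
  have "stored ?s" unfolding stored_def
  proof (intro conjI allI impI)
    show "rvar ?s 0 = 2 * c"
      using I by (simp add: c scale_inv_def prog_setup_def mem_simps of_rat_add of_rat_mult algebra_simps)
    show "rvar ?s 6 = 1 / 2"
      by (simp add: prog_setup_def mem_simps of_rat_divide)
  qed (use I entry sentinel in \<open>simp_all add: scale_inv_def prog_setup_def mem_simps\<close>)
  moreover have "written (\<lambda>_. 0) ?s"
    using I by (simp add: written_def scale_inv_def prog_setup_def mem_simps input_memory_def Let_def)
  moreover have "nvar ?s 3 = 0" "rarr ?s 2 = (\<lambda>_. 0)"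
    using I by (simp_all add: scale_inv_def prog_setup_def mem_simps)
  ultimately show ?thesis
    by (simp add: walk_inv_def reachable_def offset_def row_sum_def)
qed

lemma exec_balance_prog:
  assumes c: "c = 2 * (real K + 3) * real (log_scale (dim_col A) (nnz A))"
  shows "\<exists>T \<le> 50 * max 1 (nnz A). exec T (balance_prog K) (input_memory A)
    (walk_inv (dim_col A)) (walk_upto (dim_col A))"
proof -
  obtain T where T: "T \<le> 33 * nnz A + 1"
    and ex: "\<And>s. walk_inv 0 (\<lambda>_. 0) s \<Longrightarrow>
      exec T [Loop (NLess 3 2) column_body] s (walk_inv (dim_col A)) (walk_upto (dim_col A))"
    using exec_walk[of 0] by (auto simp: offset_def)
  have start: "exec_det (length prog_start) prog_start (input_memory A) (scale_inv A 0)"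
    by (rule exec_straight)
      (simp_all add: prog_start_def scale_inv_def mem_simps input_memory_def Let_def length_nz_positions)
  have init: "exec_det (length (prog_setup K)) (prog_setup K) s (walk_inv 0 (\<lambda>_. 0))"
    if "scale_inv A (nnz A) s" for s
    by (rule exec_straight) (use walk_inv_start[OF c that] in \<open>simp_all add: prog_setup_def\<close>)
  have "exec (length prog_start + ((nnz A * 5 + 1) + (length (prog_setup K) + T)))
      (balance_prog K) (input_memory A) (walk_inv (dim_col A)) (walk_upto (dim_col A))"
    unfolding balance_prog_def
    by (intro exec_det_append[OF start] exec_det_append[OF exec_scale] exec_det_append[OF init] ex)
  \<comment> \<open>The sum is at most \<open>38 * nnz A + 12\<close>.\<close>
  moreover have "length prog_start + ((nnz A * 5 + 1) + (length (prog_setup K) + T)) \<le> 50 * max 1 (nnz A)"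
    using T by (simp add: prog_start_def prog_setup_def)
  ultimately show ?thesis by blast
qed

definition sign_vec :: "(nat \<Rightarrow> real) \<Rightarrow> real vec" where
  "sign_vec x = vec (dim_col A) (\<lambda>j. if x j = 0 then 1 else x j)"

lemma output_pmf_balance_prog:
  assumes c: "c = 2 * (real K + 3) * real (log_scale (dim_col A) (nnz A))"
  shows "halts_within (balance_prog K) (input_memory A) (50 * max 1 (nnz A))"
    and "output_pmf (balance_prog K) A (50 * max 1 (nnz A)) = map_pmf sign_vec (walk_upto (dim_col A))"
proof -
  obtain T where T: "T \<le> 50 * max 1 (nnz A)" and ex: "exec T (balance_prog K) (input_memory A)
    (walk_inv (dim_col A)) (walk_upto (dim_col A))"
    using exec_balance_prog[OF c] by blast
  show "halts_within (balance_prog K) (input_memory A) (50 * max 1 (nnz A))"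
    by (rule exec_halts_within[OF ex T])
  show "output_pmf (balance_prog K) A (50 * max 1 (nnz A)) = map_pmf sign_vec (walk_upto (dim_col A))"
    unfolding output_pmf_def
    by (rule exec_output[OF ex T]) (auto simp: sign_vec_def walk_inv_def written_def)
qed

lemma sign_vec_in_sign_vecs: "reachable (dim_col A) x \<Longrightarrow> sign_vec x \<in> sign_vecs (dim_col A)"
  by (auto simp: sign_vec_def sign_vecs_def reachable_def split: if_splits)

text \<open>After all columns only zero columns lack a sign, and giving them sign 1 does not change
  the product.\<close>

lemma mult_sign_vec:
  assumes "reachable (dim_col A) x" "i < dim_row A"
  shows "(A *\<^sub>v sign_vec x) $ i = row_sum x i"
proof -
  have "A $$ (i, j) * (if x j = 0 then 1 else x j) = A $$ (i, j) * x j" if j: "j < dim_col A" for j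
  proof (cases "zero_col j")
    case True
    thus ?thesis using assms(2) by (simp add: zero_col_def)
  next
    case False
    thus ?thesis using assms(1) that by (auto simp: reachable_def)
  qed
  hence "(\<Sum>j<dim_col A. A $$ (i, j) * (if x j = 0 then 1 else x j)) = row_sum x i"
    unfolding row_sum_def by (intro sum.cong) auto
  thus ?thesis using assms(2)
    by (simp add: sign_vec_def scalar_prod_def atLeast0LessThan)
qed

lemma card_nonzero_cols: "card {j. j < dim_col A \<and> \<not> zero_col j} \<le> nnz A"
proof -
  have "card {j. j < dim_col A \<and> \<not> zero_col j} = (\<Sum>j<dim_col A. of_bool (\<not> zero_col j))"
    by (simp add: of_bool_def sum.If_cases Int_def)
  also have "\<dots> \<le> (\<Sum>j<dim_col A. length (nz_rows A j))"
    by (intro sum_mono) (auto simp: zero_col_iff Suc_le_eq)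
  also have "\<dots> = nnz A" by (simp flip: offset_def add: offset_dim_col)
  finally show ?thesis .
qed

end

section \<open>The final probability estimate\<close>

lemma tail_le_half_power:
  fixes x e :: real
  assumes x: "2 \<le> x" and e: "(real K + 3) * ln x \<le> e"
  shows "2 * x * exp (- e) \<le> 1 / (2 * x ^ K)"
proof -
  have "exp (- e) \<le> exp (- ((real K + 3) * ln x))" using e by simp
  also have "(real K + 3) * ln x = ln (x ^ (K + 3))"
    using x by (simp add: ln_realpow algebra_simps)
  also have "exp (- ln (x ^ (K + 3))) = 1 / x ^ (K + 3)"
    using x by (simp add: exp_minus divide_inverse)
  finally have "2 * x * exp (- e) \<le> 2 * x * (1 / x ^ (K + 3))"
    using x by (intro mult_left_mono) auto
  \<comment> \<open>Of the three surplus powers of \<open>x\<close>, one cancels the factor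
    \<open>x\<close>; the other two are worth at least 4 and turn the 2 into
    \<open>1 / 2\<close>.\<close>
  also have "\<dots> = 2 / (x ^ K * x\<^sup>2)"
    using x by (simp add: power_add power2_eq_square numeral_eq_Suc)
  also have "\<dots> \<le> 2 / (x ^ K * 2\<^sup>2)"
    using x by (intro divide_left_mono mult_left_mono power_mono mult_pos_pos) auto
  finally show ?thesis by simp
qed

text \<open>\<open>c\<close> is chosen to make clamping improbable, and \<open>r\<close> to make
  \<open>r^2 / (2 * c)\<close> at least \<open>real K + 3\<close> times the logarithm of the number
  of rows. Each of the two failures then takes half of the allowed probability.\<close>

lemma prob_balanced:
  fixes A :: "real mat" and K :: nat
  defines "c \<equiv> 2 * (real K + 3) * real (log_scale (dim_col A) (nnz A))"
    and "r \<equiv> 4 * (real K + 3) * sqrt (ln (real (dim_col A)) * ln (real (dim_row A)))"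
  assumes n: "2 \<le> dim_row A" and t: "2 \<le> dim_col A"
    and unit: "\<And>j. j < dim_col A \<Longrightarrow> l2_norm (col A j) \<le> 1"
  shows "measure_pmf.prob (output_pmf (balance_prog K) A (50 * max 1 (nnz A)))
      {x \<in> sign_vecs (dim_col A). linf_norm (A *\<^sub>v x) \<le> r}
    \<ge> 1 - 1 / real (min (dim_row A) (dim_col A)) ^ K"
proof -
  let ?n = "dim_row A" and ?t = "dim_col A" and ?L = "log_scale (dim_col A) (nnz A)"
  interpret matrix_walk A c .
  have L: "1 \<le> real ?L" using scale_pos[of ?t "nnz A"] by simp
  have L_le_c: "real ?L \<le> c"
    unfolding c_def using mult_right_mono[of 1 "2 * (real K + 3)" "real ?L"] by simp
  interpret unit_balancing_walk "\<lambda>i j. A $$ (i, j)" ?n ?t c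
  proof
    fix j assume j: "j < ?t"
    have "sqrt (\<Sum>i<?n. (A $$ (i, j))\<^sup>2) \<le> 1"
      using unit[OF j] j by (simp add: l2_norm_def L2_set_def)
    thus "(\<Sum>i<?n. (A $$ (i, j))\<^sup>2) \<le> 1" by simp
  qed (use L L_le_c in simp)
  let ?W = "walk_upto ?t"
  have out: "output_pmf (balance_prog K) A (50 * max 1 (nnz A)) = map_pmf sign_vec ?W"
    by (rule output_pmf_balance_prog(2)) (simp add: c_def)
  have lnt: "0 < ln (real ?t)" and lnn: "0 < ln (real ?n)" using n t by auto
  have r: "0 \<le> r" unfolding r_def using lnt lnn by simp
  have "measure_pmf.prob ?W {x. \<not> tame ?t x} \<le> 1 / (2 * real ?t ^ K)"
  proof (cases "?t \<le> 2 ^ ?L")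
    case True
    have "measure_pmf.prob ?W {x. \<not> tame ?t x} \<le> 2 * real ?t * exp (- (c / 2))"
      by (rule prob_not_tame) simp
    also have "\<dots> \<le> 1 / (2 * real ?t ^ K)"
    proof (rule tail_le_half_power)
      have "(real K + 3) * ln (real ?t) \<le> (real K + 3) * real ?L"
        using ln_le_scale[OF _ True] t by (intro mult_left_mono) auto
      also have "\<dots> = c / 2" by (simp add: c_def field_simps)
      finally show "(real K + 3) * ln (real ?t) \<le> c / 2" .
    qed (use t in simp)
    finally show ?thesis .
  next
    case False
    \<comment> \<open>The doubling was cut off, so \<open>c\<close> exceeds the number of nonzero
      entries and hence of nonzero columns.\<close>
    with scale_cases[of ?t "nnz A"] have "?L = Suc (nnz A)" by simp
    hence "real (card {j. j < ?t \<and> \<not> zero_col j}) \<le> c"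
      using card_nonzero_cols L_le_c by simp
    hence "set_pmf ?W \<inter> {x. \<not> tame ?t x} = {}"
      using tame_if_few_columns reachable_walk_upto by blast
    hence "measure_pmf.prob ?W {x. \<not> tame ?t x} = 0" by (simp only: measure_pmf_zero_iff)
    thus ?thesis by simp
  qed
  moreover have "2 * real ?n * exp (- (r\<^sup>2 / (2 * c))) \<le> 1 / (2 * real ?n ^ K)"
  proof (rule tail_le_half_power)
    \<comment> \<open>\<open>scale_le_ln\<close> gives
      \<open>c \<le> 8 * (real K + 3) * ln (real ?t)\<close>; this is where the 4 in
      \<open>r\<close> comes from.\<close>
    have "2 * (real K + 3) * c \<le> (4 * (real K + 3))\<^sup>2 * ln (real ?t)"
      using mult_left_mono[OF scale_le_ln[OF t, of "nnz A"], of "4 * (real K + 3)\<^sup>2"]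
      by (simp add: c_def power2_eq_square algebra_simps)
    hence "2 * (real K + 3) * c * ln (real ?n) \<le> (4 * (real K + 3))\<^sup>2 * ln (real ?t) * ln (real ?n)"
      using lnn by (intro mult_right_mono) auto
    also have "\<dots> = r\<^sup>2"
      unfolding r_def power_mult_distrib using lnt lnn by simp
    finally show "(real K + 3) * ln (real ?n) \<le> r\<^sup>2 / (2 * c)"
      using c_ge_1 by (simp add: field_simps)
  qed (use n in simp)
  ultimately have "measure_pmf.prob ?W {x. \<exists>i<?n. r < \<bar>row_sum x i\<bar>} \<le>
      1 / (2 * real ?t ^ K) + 1 / (2 * real ?n ^ K)"
    using prob_row_sums[OF r] by linarith
  also have "\<dots> \<le> 1 / (2 * real (min ?n ?t) ^ K) + 1 / (2 * real (min ?n ?t) ^ K)"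
    using n t by (intro add_mono divide_left_mono mult_left_mono power_mono mult_pos_pos) auto
  finally have bad: "measure_pmf.prob ?W {x. \<exists>i<?n. r < \<bar>row_sum x i\<bar>} \<le> 1 / real (min ?n ?t) ^ K"
    by simp
  have "1 - measure_pmf.prob ?W {x. \<exists>i<?n. r < \<bar>row_sum x i\<bar>} =
      measure_pmf.prob ?W (- {x. \<exists>i<?n. r < \<bar>row_sum x i\<bar>})"
    using measure_pmf.prob_compl[of "{x. \<exists>i<?n. r < \<bar>row_sum x i\<bar>}" ?W]
    by (simp add: Compl_eq_Diff_UNIV)
  \<comment> \<open>Only reachable states yield sign vectors, so the event is first restricted to
    the support.\<close>
  also have "\<dots> = measure_pmf.prob ?W (- {x. \<exists>i<?n. r < \<bar>row_sum x i\<bar>} \<inter> set_pmf ?W)"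
    by (rule measure_Int_set_pmf[symmetric])
  also have "\<dots> \<le> measure_pmf.prob ?W (sign_vec -` {x \<in> sign_vecs ?t. linf_norm (A *\<^sub>v x) \<le> r})"
  proof (rule measure_pmf.finite_measure_mono)
    show "- {x. \<exists>i<?n. r < \<bar>row_sum x i\<bar>} \<inter> set_pmf ?W \<subseteq>
        sign_vec -` {x \<in> sign_vecs ?t. linf_norm (A *\<^sub>v x) \<le> r}"
    proof
      fix x assume "x \<in> - {x. \<exists>i<?n. r < \<bar>row_sum x i\<bar>} \<inter> set_pmf ?W"
      hence x: "x \<in> set_pmf ?W" "\<And>i. i < ?n \<Longrightarrow> \<bar>row_sum x i\<bar> \<le> r"
        unfolding not_less[symmetric] by blast+
      have x': "reachable ?t x" by (rule reachable_walk_upto[OF x(1)])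
      have "sign_vec x \<in> sign_vecs ?t" by (rule sign_vec_in_sign_vecs[OF x'])
      moreover have "{..<?n} \<noteq> {}" using n by (auto simp: lessThan_empty_iff)
      hence "linf_norm (A *\<^sub>v sign_vec x) \<le> r"
        unfolding linf_norm_def using x(2) mult_sign_vec[OF x']
        by (subst Max_le_iff) (auto simp del: index_mult_mat_vec)
      ultimately show "x \<in> sign_vec -` {x \<in> sign_vecs ?t. linf_norm (A *\<^sub>v x) \<le> r}"
        by simp
    qed
  qed auto
  also have "\<dots> = measure_pmf.prob (output_pmf (balance_prog K) A (50 * max 1 (nnz A)))
      {x \<in> sign_vecs ?t. linf_norm (A *\<^sub>v x) \<le> r}"
    unfolding out by simp
  finally show ?thesis using bad by linarith
qed

text \<open>High probability means failure at most an inverse power of \<open>min n t\<close> with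
  any prescribed exponent \<open>K\<close>, which is built into the program text.
  \<open>max 1 (nnz A)\<close> allows constant time for the zero matrix, and
  \<open>n, t \<ge> 2\<close> make both logarithms positive.\<close>

theorem theorem1p2:
  fixes K :: nat
  shows "\<exists>(P :: prog) (C :: real) (c :: nat). C > 0 \<and>
    (\<forall>(n :: nat) (t :: nat) (A :: real mat).
       n \<ge> 2 \<and> t \<ge> 2 \<and> A \<in> carrier_mat n t \<and> (\<forall>j<t. l2_norm (col A j) \<le> 1) \<longrightarrow>
       halts_within P (input_memory A) (c * max 1 (nnz A)) \<and>
       measure_pmf.prob (output_pmf P A (c * max 1 (nnz A)))
         {x \<in> sign_vecs t. linf_norm (A *\<^sub>v x) \<le> C * sqrt (ln (real t) * ln (real n))}
         \<ge> 1 - 1 / real (min n t) ^ K)"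
proof (rule exI[of _ "balance_prog K"], rule exI[of _ "4 * (real K + 3)"], rule exI[of _ 50],
    intro conjI allI impI)
  fix n t and A :: "real mat"
  assume H: "n \<ge> 2 \<and> t \<ge> 2 \<and> A \<in> carrier_mat n t \<and> (\<forall>j<t. l2_norm (col A j) \<le> 1)"
  hence A: "dim_row A = n" "dim_col A = t" by auto
  show "halts_within (balance_prog K) (input_memory A) (50 * max 1 (nnz A))"
    by (rule matrix_walk.output_pmf_balance_prog(1)[OF refl])
  show "1 - 1 / real (min n t) ^ K \<le> measure_pmf.prob (output_pmf (balance_prog K) A (50 * max 1 (nnz A)))
      {x \<in> sign_vecs t. linf_norm (A *\<^sub>v x) \<le> 4 * (real K + 3) * sqrt (ln (real t) * ln (real n))}"
    using prob_balanced[of A K] H A by simp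
qed simp

end
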